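(* Let $r\in\mathbb{N}$ and let $G$ be a locally finite connected graph which does not have $K_r$-minors. Let $d_G$ be the graph distance on $G$. Then the metric space $(G,d_G)$ embeds coarsely into $L_1$.
   Context: A connected graph is regarded as a metric space by identifying it with its vertex set endowed with the standard graph distance $d_G$ (the number of edges in a shortest path). A graph is locally finite if every vertex has finite degree (for a connected graph, equivalently, all balls in $(G,d_G)$ are finite); the graph may be infinite. $K_r$ is the complete graph on $r$ vertices; $G$ has a $K_r$-minor if there are $r$ pairwise disjoint nonempty connected sets of vertices of $G$ such that between any two of them there is an edge of $G$. A map $f:A\to B$ between metric spaces is a coarse embedding if there exist non-decreasing functions $\rho_1,\rho_2:[0,\infty)\to[0,\infty)$ such that $\rho_1(d_A(x,y))\le d_B(f(x),f(y))\le\rho_2(d_A(x,y))$ for all $x,y\in A$ and $\lim_{t\to\infty}\rho_1(t)=\infty$; $A$ embeds coarsely into $B$ if such a map exists. $L_1$ denotes the Banach space $L_1[0,1]$ with its norm metric. *)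

theory Defs
  imports "HOL-Analysis.Analysis"
begin

text \<open>
  A simple graph is given by a vertex set and an adjacency predicate; it may be infinite.
  The vertex set is allowed to be empty, and the empty graph counts as connected.
\<close>

locale simple_graph =
  fixes V :: "'a set" and adj :: "'a \<Rightarrow> 'a \<Rightarrow> bool"
  assumes adj_in_V: "adj x y \<Longrightarrow> x \<in> V \<and> y \<in> V"
    and adj_sym: "adj x y \<Longrightarrow> adj y x"
    and adj_irrefl: "\<not> adj x x"

definition path_in :: "'a set \<Rightarrow> ('a \<Rightarrow> 'a \<Rightarrow> bool) \<Rightarrow> 'a \<Rightarrow> 'a \<Rightarrow> 'a list \<Rightarrow> bool" where
  "path_in S adj x y p \<longleftrightarrow>
     p \<noteq> [] \<and> hd p = x \<and> last p = y \<and> set p \<subseteq> S \<and> distinct p \<and> successively adj p"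

text \<open>Connectedness of the subgraph induced by \<open>S\<close>; for \<open>S = V\<close>, of the graph itself.\<close>

definition connected_on :: "'a set \<Rightarrow> ('a \<Rightarrow> 'a \<Rightarrow> bool) \<Rightarrow> bool" where
  "connected_on S adj \<longleftrightarrow> (\<forall>x\<in>S. \<forall>y\<in>S. \<exists>p. path_in S adj x y p)"

definition locally_finite_graph :: "'a set \<Rightarrow> ('a \<Rightarrow> 'a \<Rightarrow> bool) \<Rightarrow> bool" where
  "locally_finite_graph V adj \<longleftrightarrow> (\<forall>v\<in>V. finite {w \<in> V. adj v w})"

text \<open>A path with \<open>n\<close> edges has \<open>n + 1\<close> vertices.\<close>

definition graph_dist :: "'a set \<Rightarrow> ('a \<Rightarrow> 'a \<Rightarrow> bool) \<Rightarrow> 'a \<Rightarrow> 'a \<Rightarrow> nat" where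
  "graph_dist V adj x y = (LEAST n. \<exists>p. path_in V adj x y p \<and> length p = n + 1)"

definition has_complete_minor :: "nat \<Rightarrow> 'a set \<Rightarrow> ('a \<Rightarrow> 'a \<Rightarrow> bool) \<Rightarrow> bool" where
  "has_complete_minor r V adj \<longleftrightarrow>
     (\<exists>B :: nat \<Rightarrow> 'a set.
        (\<forall>i<r. B i \<noteq> {} \<and> B i \<subseteq> V \<and> connected_on (B i) adj) \<and>
        (\<forall>i<r. \<forall>j<r. i \<noteq> j \<longrightarrow> B i \<inter> B j = {} \<and> (\<exists>x\<in>B i. \<exists>y\<in>B j. adj x y)))"

definition coarse_embedding ::
    "'a set \<Rightarrow> ('a \<Rightarrow> 'a \<Rightarrow> real) \<Rightarrow> 'b set \<Rightarrow> ('b \<Rightarrow> 'b \<Rightarrow> real) \<Rightarrow> ('a \<Rightarrow> 'b) \<Rightarrow> bool" where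
  "coarse_embedding A dA B dB f \<longleftrightarrow>
     f \<in> A \<rightarrow> B \<and>
     (\<exists>\<rho>1 \<rho>2 :: real \<Rightarrow> real.
        \<rho>1 \<in> {0..} \<rightarrow> {0..} \<and> \<rho>2 \<in> {0..} \<rightarrow> {0..} \<and>
        mono_on {0..} \<rho>1 \<and> mono_on {0..} \<rho>2 \<and>
        (\<forall>x\<in>A. \<forall>y\<in>A. \<rho>1 (dA x y) \<le> dB (f x) (f y) \<and> dB (f x) (f y) \<le> \<rho>2 (dA x y)) \<and>
        filterlim \<rho>1 at_top at_top)"

definition embeds_coarsely ::
    "'a set \<Rightarrow> ('a \<Rightarrow> 'a \<Rightarrow> real) \<Rightarrow> 'b set \<Rightarrow> ('b \<Rightarrow> 'b \<Rightarrow> real) \<Rightarrow> bool" where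
  "embeds_coarsely A dA B dB \<longleftrightarrow> (\<exists>f. coarse_embedding A dA B dB f)"

text \<open>
  The real space $L_1[0,1]$: Lebesgue integrable functions on \<open>{0..1}\<close> up to equality
  almost everywhere. Representatives are total functions, but \<open>lebesgue_on {0..1}\<close> ignores
  their values outside the unit interval.
\<close>

quotient_type L1 = "real \<Rightarrow> real" / partial:
  "\<lambda>f g. integrable (lebesgue_on {0..1}) f \<and> integrable (lebesgue_on {0..1}) g \<and>
         (AE x in lebesgue_on {0..1}. f x = g x)"
proof (rule part_equivpI)
  show "\<exists>f :: real \<Rightarrow> real. integrable (lebesgue_on {0..1}) f \<and>
          integrable (lebesgue_on {0..1}) f \<and> (AE x in lebesgue_on {0..1}. f x = f x)"
    by (intro exI[of _ "\<lambda>_. 0"]) simp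
qed (auto intro!: sympI transpI)

instantiation L1 :: real_vector
begin

lift_definition zero_L1 :: L1 is "\<lambda>_. 0" by simp

lift_definition plus_L1 :: "L1 \<Rightarrow> L1 \<Rightarrow> L1" is "\<lambda>f g x. f x + g x" by auto

lift_definition minus_L1 :: "L1 \<Rightarrow> L1 \<Rightarrow> L1" is "\<lambda>f g x. f x - g x" by auto

lift_definition uminus_L1 :: "L1 \<Rightarrow> L1" is "\<lambda>f x. - f x" by auto

lift_definition scaleR_L1 :: "real \<Rightarrow> L1 \<Rightarrow> L1" is "\<lambda>c f x. c * f x" by auto

instance
proof
  fix f g h :: L1 and a b :: real
  show "f + g + h = f + (g + h)" by transfer (auto simp: add.assoc)
  show "f + g = g + f" by transfer (auto simp: add.commute)
  show "0 + f = f" by transfer auto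
  show "- f + f = 0" by transfer auto
  show "f - g = f + - g" by transfer auto
  show "a *\<^sub>R (f + g) = a *\<^sub>R f + a *\<^sub>R g" by transfer (auto simp: distrib_left)
  show "(a + b) *\<^sub>R f = a *\<^sub>R f + b *\<^sub>R f" by transfer (auto simp: distrib_right)
  show "a *\<^sub>R b *\<^sub>R f = (a * b) *\<^sub>R f" by transfer (auto simp: mult.assoc)
  show "1 *\<^sub>R f = f" by transfer auto
qed

end

instantiation L1 :: real_normed_vector
begin

lift_definition norm_L1 :: "L1 \<Rightarrow> real" is "\<lambda>f. \<integral>x. \<bar>f x\<bar> \<partial>lebesgue_on {0..1}"
  by (rule integral_cong_AE) auto

definition dist_L1 :: "L1 \<Rightarrow> L1 \<Rightarrow> real" where "dist_L1 f g = norm (f - g)"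

definition sgn_L1 :: "L1 \<Rightarrow> L1" where "sgn_L1 f = f /\<^sub>R norm f"

definition uniformity_L1 :: "(L1 \<times> L1) filter" where
  "uniformity_L1 = (INF e\<in>{0 <..}. principal {(x, y). dist x y < e})"

definition open_L1 :: "L1 set \<Rightarrow> bool" where
  "open_L1 U \<longleftrightarrow> (\<forall>x\<in>U. \<forall>\<^sub>F (x', y) in uniformity. x' = x \<longrightarrow> y \<in> U)"

instance
proof
  fix f g :: L1 and a :: real
  show "norm f = 0 \<longleftrightarrow> f = 0"
    by transfer (subst integral_nonneg_eq_0_iff_AE, auto)
  show "norm (f + g) \<le> norm f + norm g"
  proof transfer
    fix f g :: "real \<Rightarrow> real"
    let ?M = "lebesgue_on {0..1::real}"
    assume "integrable ?M f \<and> integrable ?M f \<and> (AE x in ?M. f x = f x)"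
      and "integrable ?M g \<and> integrable ?M g \<and> (AE x in ?M. g x = g x)"
    then have f: "integrable ?M f" and g: "integrable ?M g" by auto
    have "(\<integral>x. \<bar>f x + g x\<bar> \<partial>?M) \<le> (\<integral>x. \<bar>f x\<bar> + \<bar>g x\<bar> \<partial>?M)"
      using f g by (intro integral_mono) auto
    also have "\<dots> = (\<integral>x. \<bar>f x\<bar> \<partial>?M) + (\<integral>x. \<bar>g x\<bar> \<partial>?M)"
      using f g by simp
    finally show "(\<integral>x. \<bar>f x + g x\<bar> \<partial>?M) \<le> (\<integral>x. \<bar>f x\<bar> \<partial>?M) + (\<integral>x. \<bar>g x\<bar> \<partial>?M)" .
  qed
  show "norm (a *\<^sub>R f) = \<bar>a\<bar> * norm f" by transfer (simp add: abs_mult)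
qed (rule dist_L1_def sgn_L1_def uniformity_L1_def open_L1_def)+

end

lemma dist_abs_L1:
  assumes "integrable (lebesgue_on {0..1}) f" and "integrable (lebesgue_on {0..1}) g"
  shows "dist (abs_L1 f) (abs_L1 g) = (\<integral>x. \<bar>f x - g x\<bar> \<partial>lebesgue_on {0..1})"
  using assms by (simp add: dist_L1_def minus_L1.abs_eq norm_L1.abs_eq)

end

theory Submission
  imports Defs "HOL-Number_Theory.Cong"
begin

text \<open>
  Klein, Plotkin and Rao: cut a \<open>K\<^sub>r\<close>-minor-free graph \<open>r\<close> times in a row, each time splitting every
  cluster into the components of annuli of width \<open>\<Delta>\<close> around a root of that cluster, with respect to
  its intrinsic distance. The resulting clusters have bounded diameter in the whole graph:
  otherwise a cluster contains \<open>r\<close> vertices far from each other, and undoing the cuts one by one,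
  each of them makes one more of \<open>r\<close> disjoint connected sets adjacent to all others. For uniformly
  random offsets of the annuli, two vertices are separated with probability at most \<open>r d / \<Delta>\<close>,
  where \<open>d\<close> is their distance. Summing the cut metrics of these partitions over the widths
  \<open>\<Delta> = 2 ^ n\<close> gives an \<open>L\<^sub>1\<close> metric that is bounded above by \<open>2 r d\<close> and below by the number of
  scales at which every partition separates the two vertices.
\<close>

subsection \<open>Heights in induced subgraphs\<close>

context simple_graph
begin

text \<open>The ball of radius \<open>n\<close> in the subgraph induced by \<open>S\<close>, built
  from walks instead of the repetition-free paths of \<open>path_in\<close>, so that concatenation
  needs no care. The centre belongs to its ball even when it lies outside \<open>S\<close>, whence
  the hypothesis \<open>x \<in> S\<close> in many facts below.\<close>

primrec nbhd :: "'a set \<Rightarrow> nat \<Rightarrow> 'a \<Rightarrow> 'a set" where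
  "nbhd S 0 x = {x}"
| "nbhd S (Suc n) x = nbhd S n x \<union> {y \<in> S. \<exists>u\<in>nbhd S n x. adj u y}"

definition comp_of :: "'a set \<Rightarrow> 'a \<Rightarrow> 'a set" where
  "comp_of S x = (\<Union>n. nbhd S n x)"

definition walk_connected :: "'a set \<Rightarrow> bool" where
  "walk_connected S \<longleftrightarrow> (\<forall>x\<in>S. S \<subseteq> comp_of S x)"

text \<open>The intrinsic distance in \<open>S\<close>, possibly larger than the distance in the
  whole graph; it is meaningful only for \<open>y \<in> comp_of S x\<close>.\<close>

definition height :: "'a set \<Rightarrow> 'a \<Rightarrow> 'a \<Rightarrow> nat" where
  "height S x y = (LEAST n. y \<in> nbhd S n x)"

lemma nbhd_self: "x \<in> nbhd S n x"
  by (induction n) auto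

lemma nbhd_subset: "x \<in> S \<Longrightarrow> nbhd S n x \<subseteq> S"
  by (induction n) auto

lemma nbhd_mono: "m \<le> n \<Longrightarrow> nbhd S m x \<subseteq> nbhd S n x"
  by (rule lift_Suc_mono_le[of "\<lambda>n. nbhd S n x"]) auto

lemma nbhd_mono_set: "S \<subseteq> T \<Longrightarrow> nbhd S n x \<subseteq> nbhd T n x"
  by (induction n) auto

lemma nbhd_trans: "y \<in> nbhd S m x \<Longrightarrow> z \<in> nbhd S n y \<Longrightarrow> z \<in> nbhd S (m + n) x"
proof (induction n arbitrary: z)
  case (Suc n)
  then show ?case by auto
qed auto

lemma nbhd_adj: "adj x y \<Longrightarrow> y \<in> S \<Longrightarrow> y \<in> nbhd S 1 x"
  by auto

lemma nbhd_sym: "x \<in> S \<Longrightarrow> y \<in> nbhd S n x \<Longrightarrow> x \<in> nbhd S n y"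
proof (induction n arbitrary: y)
  case (Suc n)
  show ?case
  proof (cases "y \<in> nbhd S n x")
    case True
    then show ?thesis using Suc by auto
  next
    case False
    then obtain u where u: "u \<in> nbhd S n x" "adj u y" using Suc.prems by auto
    have "u \<in> S" using u nbhd_subset Suc.prems(1) by blast
    then have "u \<in> nbhd S 1 y" using u(2) adj_sym nbhd_adj by blast
    moreover have "x \<in> nbhd S n u" using Suc u by auto
    ultimately show ?thesis using nbhd_trans by fastforce
  qed
qed auto

lemma comp_of_self: "x \<in> comp_of S x"
  unfolding comp_of_def using nbhd_self by blast

lemma comp_of_subset: "x \<in> S \<Longrightarrow> comp_of S x \<subseteq> S"
  unfolding comp_of_def using nbhd_subset by blast

lemma comp_of_sym: "x \<in> S \<Longrightarrow> y \<in> comp_of S x \<Longrightarrow> x \<in> comp_of S y"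
  unfolding comp_of_def using nbhd_sym by blast

lemma comp_of_trans: "y \<in> comp_of S x \<Longrightarrow> z \<in> comp_of S y \<Longrightarrow> z \<in> comp_of S x"
  unfolding comp_of_def by (auto intro: nbhd_trans)

lemma comp_of_eq: "x \<in> S \<Longrightarrow> y \<in> comp_of S x \<Longrightarrow> comp_of S y = comp_of S x"
  using comp_of_sym comp_of_trans by blast

lemma comp_of_adj: "y \<in> comp_of S x \<Longrightarrow> adj y z \<Longrightarrow> z \<in> S \<Longrightarrow> z \<in> comp_of S x"
  by (rule comp_of_trans) (auto simp: comp_of_def intro: exI[of _ 1])

lemma comp_of_mono: "S \<subseteq> T \<Longrightarrow> comp_of S x \<subseteq> comp_of T x"
  unfolding comp_of_def by (intro UN_mono nbhd_mono_set) auto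

lemma walk_connectedI: "x \<in> S \<Longrightarrow> S \<subseteq> comp_of S x \<Longrightarrow> walk_connected S"
  unfolding walk_connected_def by (metis comp_of_eq subsetD)

lemma walk_connected_comp_of:
  assumes "x \<in> S" shows "walk_connected (comp_of S x)"
proof (rule walk_connectedI[OF comp_of_self])
  \<comment> \<open>A walk in \<open>S\<close> from \<open>x\<close> never leaves the component of
    \<open>x\<close>, so it is also a walk inside that component.\<close>
  have "nbhd S n x \<subseteq> nbhd (comp_of S x) n x" for n
  proof (induction n)
    case (Suc n)
    have "nbhd S (Suc n) x \<subseteq> comp_of S x" unfolding comp_of_def by blast
    then show ?case using Suc by auto
  qed auto
  then show "comp_of S x \<subseteq> comp_of (comp_of S x) x"
    unfolding comp_of_def[of S] comp_of_def[of "\<Union>n. nbhd S n x"] by blast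
qed

lemma walk_connected_Un_adj:
  assumes "walk_connected A" "walk_connected B" "a \<in> A" "b \<in> B" "adj a b"
  shows "walk_connected (A \<union> B)"
proof (rule walk_connectedI[of a])
  have "A \<subseteq> comp_of (A \<union> B) a"
    using assms comp_of_mono[of A "A \<union> B" a] unfolding walk_connected_def by blast
  moreover have "b \<in> comp_of (A \<union> B) a"
    using comp_of_adj[OF comp_of_self] assms by blast
  then have "B \<subseteq> comp_of (A \<union> B) a"
    using assms comp_of_mono[of B "A \<union> B" b] comp_of_trans[of b "A \<union> B" a]
    unfolding walk_connected_def by blast
  ultimately show "A \<union> B \<subseteq> comp_of (A \<union> B) a" by simp
qed (use assms in auto)

lemma walk_connected_Un:
  assumes "walk_connected A" "walk_connected B" "a \<in> A" "a \<in> B"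
  shows "walk_connected (A \<union> B)"
proof (rule walk_connectedI[of a])
  show "A \<union> B \<subseteq> comp_of (A \<union> B) a"
    using assms comp_of_mono[of A "A \<union> B" a] comp_of_mono[of B "A \<union> B" a]
    unfolding walk_connected_def by blast
qed (use assms in auto)

text \<open>Used to see that segments of a geodesic, given as images of index intervals, are
  connected.\<close>

lemma chain_in_comp_of:
  fixes m n :: nat
  assumes "\<And>k. m \<le> k \<Longrightarrow> k \<le> n \<Longrightarrow> f k \<in> S" "\<And>k. m \<le> k \<Longrightarrow> k < n \<Longrightarrow> adj (f k) (f (Suc k))"
    "m \<le> n"
  shows "f n \<in> comp_of S (f m)"
  using assms(3,1,2)
proof (induction n rule: dec_induct)
  case base
  show ?case by (rule comp_of_self)
next
  case (step k)
  show ?case by (rule comp_of_adj[of "f k"]) (use step in auto)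
qed

section \<open>Distance from a root and geodesics towards it\<close>

lemma height_le: "y \<in> nbhd S n x \<Longrightarrow> height S x y \<le> n"
  unfolding height_def by (rule Least_le)

lemma in_nbhd_height: "y \<in> comp_of S x \<Longrightarrow> y \<in> nbhd S (height S x y) x"
  unfolding height_def comp_of_def by (rule LeastI_ex) auto

lemma in_nbhd_iff_height: "y \<in> comp_of S x \<Longrightarrow> y \<in> nbhd S n x \<longleftrightarrow> height S x y \<le> n"
  using height_le in_nbhd_height nbhd_mono by blast

lemma height_self: "height S x x = 0"
  using height_le[OF nbhd_self, of S x 0] by simp

lemma height_nbhd:
  assumes "y \<in> comp_of S x" "z \<in> nbhd S n y"
  shows "height S x z \<le> height S x y + n"
  by (intro height_le nbhd_trans[OF in_nbhd_height[OF assms(1)] assms(2)])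

lemma height_adj:
  assumes "y \<in> comp_of S x" "adj y z" "z \<in> S"
  shows "height S x z \<le> height S x y + 1"
  using height_nbhd[OF assms(1) nbhd_adj[OF assms(2,3)]] .

lemma height_parent:
  assumes "y \<in> comp_of S x" "x \<in> S" "height S x y \<noteq> 0"
  shows "\<exists>z\<in>S. adj y z \<and> Suc (height S x z) = height S x y"
proof -
  obtain n where n: "height S x y = Suc n" using assms(3) not0_implies_Suc by blast
  have "y \<in> nbhd S (Suc n) x" using in_nbhd_height[OF assms(1)] n by simp
  moreover have "y \<notin> nbhd S n x" using height_le n by fastforce
  ultimately obtain u where u: "u \<in> nbhd S n x" "adj u y" "y \<in> S" by auto
  have "u \<in> comp_of S x" using u unfolding comp_of_def by blast
  then have "height S x y \<le> height S x u + 1" using height_adj u by blast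
  moreover have "height S x u \<le> n" using u height_le by blast
  ultimately show ?thesis using u n adj_sym nbhd_subset[OF assms(2)] by (intro bexI[of _ u]) auto
qed

text \<open>Choosing for each vertex a neighbour one step closer to the root and iterating the
  choice traces a geodesic. Stating this for all powers of \<open>par\<close> lets initial and final
  segments be cut off at any height.\<close>

lemma height_descent:
  assumes "walk_connected S" "x \<in> S"
  obtains par where "\<And>y n. y \<in> S \<Longrightarrow> n \<le> height S x y \<Longrightarrow>
      (par ^^ n) y \<in> S \<and> height S x ((par ^^ n) y) = height S x y - n \<and> (par ^^ n) y \<in> nbhd S n y"
    and "\<And>y n. y \<in> S \<Longrightarrow> n < height S x y \<Longrightarrow> adj ((par ^^ n) y) ((par ^^ Suc n) y)"
    and "\<And>y. y \<in> S \<Longrightarrow> (par ^^ (height S x y)) y = x"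
proof -
  have comp: "y \<in> comp_of S x" if "y \<in> S" for y
    using assms that unfolding walk_connected_def by blast
  have "\<forall>y\<in>S. \<exists>z. height S x y \<noteq> 0 \<longrightarrow> z \<in> S \<and> adj y z \<and> Suc (height S x z) = height S x y"
    using height_parent[OF comp assms(2)] by blast
  then obtain par where par: "\<And>y. y \<in> S \<Longrightarrow> height S x y \<noteq> 0 \<Longrightarrow>
      par y \<in> S \<and> adj y (par y) \<and> Suc (height S x (par y)) = height S x y"
    using bchoice[of S "\<lambda>y z. height S x y \<noteq> 0 \<longrightarrow> z \<in> S \<and> adj y z \<and> Suc (height S x z) = height S x y"]
    by blast
  have 1: "(par ^^ n) y \<in> S \<and> height S x ((par ^^ n) y) = height S x y - n \<and> (par ^^ n) y \<in> nbhd S n y"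
    if "y \<in> S" "n \<le> height S x y" for y n
    using that(2)
  proof (induction n)
    case (Suc n)
    then have IH: "(par ^^ n) y \<in> S" "height S x ((par ^^ n) y) = height S x y - n"
      "(par ^^ n) y \<in> nbhd S n y" by auto
    then show ?case using par[OF IH(1)] Suc.prems by auto
  qed (use that in auto)
  have 2: "adj ((par ^^ n) y) ((par ^^ Suc n) y)" if "y \<in> S" "n < height S x y" for y n
    using 1[OF that(1), of n] par[of "(par ^^ n) y"] that by auto
  have 3: "(par ^^ (height S x y)) y = x" if "y \<in> S" for y
  proof -
    let ?z = "(par ^^ (height S x y)) y"
    have "?z \<in> S" "height S x ?z = 0" using 1[OF that order_refl] by auto
    then show ?thesis using in_nbhd_height[OF comp, of ?z] by simp
  qed
  from 1 2 3 show thesis by (rule that)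
qed

text \<open>A discrete intermediate value theorem: along a walk the value rises by at most one per
  edge and so skips no level.\<close>

lemma nbhd_intermediate_value:
  fixes f :: "'a \<Rightarrow> nat"
  assumes "\<And>u v. u \<in> S \<Longrightarrow> v \<in> S \<Longrightarrow> adj u v \<Longrightarrow> f v \<le> f u + 1"
  shows "x \<in> S \<Longrightarrow> y \<in> nbhd S n x \<Longrightarrow> f x \<le> t \<Longrightarrow> t \<le> f y \<Longrightarrow> \<exists>z\<in>S. f z = t"
proof (induction n arbitrary: y)
  case (Suc n)
  show ?case
  proof (cases "y \<in> nbhd S n x")
    case True
    then show ?thesis using Suc by blast
  next
    case False
    then obtain u where u: "u \<in> nbhd S n x" "adj u y" "y \<in> S" using Suc.prems by auto
    have "u \<in> S" using u nbhd_subset Suc.prems by blast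
    then have "f y \<le> f u + 1" using assms u by blast
    then have "t \<le> f u \<or> f y = t" using Suc.prems by linarith
    then show ?thesis using Suc u by blast
  qed
qed auto

subsection \<open>Walks and paths\<close>

lemma path_in_imp_nbhd:
  "path_in S adj x y p \<Longrightarrow> y \<in> nbhd S (length p - 1) x"
proof (induction p arbitrary: y rule: rev_induct)
  case (snoc z p)
  show ?case
  proof (cases "p = []")
    case True
    then show ?thesis using snoc.prems by (auto simp: path_in_def)
  next
    case False
    have "path_in S adj x (last p) p"
      using snoc.prems False by (auto simp: path_in_def successively_append_iff)
    then have "last p \<in> nbhd S (length p - 1) x" by (rule snoc.IH)
    moreover have "adj (last p) y" "y \<in> S"
      using snoc.prems False by (auto simp: path_in_def successively_append_iff)
    ultimately have "y \<in> nbhd S (Suc (length p - 1)) x" by auto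
    then show ?thesis using False by (cases p) auto
  qed
qed (auto simp: path_in_def)

lemma nbhd_imp_path_in:
  "x \<in> S \<Longrightarrow> y \<in> nbhd S n x \<Longrightarrow> \<exists>p. path_in S adj x y p \<and> length p \<le> n + 1"
proof (induction n arbitrary: y)
  case 0
  then show ?case by (intro exI[of _ "[x]"]) (auto simp: path_in_def)
next
  case (Suc n)
  show ?case
  proof (cases "y \<in> nbhd S n x")
    case True
    then show ?thesis using Suc by (metis add_Suc le_SucI)
  next
    case False
    then obtain u where u: "u \<in> nbhd S n x" "adj u y" "y \<in> S" using Suc.prems by auto
    then obtain p where p: "path_in S adj x u p" "length p \<le> n + 1" using Suc by blast
    show ?thesis
    proof (cases "y \<in> set p")
      case True
      \<comment> \<open>If the path already visits \<open>y\<close>, its prefix ending there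
        replaces the extension, which would repeat a vertex.\<close>
      then obtain q q' where q: "p = q @ y # q'" by (meson split_list)
      have "path_in S adj x y (q @ [y])"
        using p(1) unfolding q path_in_def
        by (cases q) (auto simp: successively_append_iff simp flip: append_Cons)
      then show ?thesis using p(2) q by (intro exI[of _ "q @ [y]"]) auto
    next
      case False
      then have "path_in S adj x y (p @ [y])"
        using p(1) u unfolding path_in_def by (auto simp: successively_append_iff)
      then show ?thesis using p(2) by (intro exI[of _ "p @ [y]"]) auto
    qed
  qed
qed

lemma connected_on_iff_walk_connected: "connected_on S adj \<longleftrightarrow> walk_connected S"
proof -
  have "(\<exists>p. path_in S adj x y p) \<longleftrightarrow> y \<in> comp_of S x" if "x \<in> S" for x y
    using path_in_imp_nbhd nbhd_imp_path_in[OF that] unfolding comp_of_def by blast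
  then show ?thesis unfolding connected_on_def walk_connected_def by blast
qed

text \<open>A walk can be shortened to a path without repetitions, so minimising over walks or over
  paths gives the same value.\<close>

lemma graph_dist_eq_height:
  assumes "x \<in> S" "y \<in> comp_of S x"
  shows "graph_dist S adj x y = height S x y"
proof (rule antisym)
  obtain p where p: "path_in S adj x y p" "length p \<le> height S x y + 1"
    using nbhd_imp_path_in in_nbhd_height assms by blast
  have pos: "p \<noteq> []" using p by (auto simp: path_in_def)
  have ex: "\<exists>n p. path_in S adj x y p \<and> length p = n + 1"
    using p pos by (intro exI[of _ "length p - 1"] exI[of _ p]) (cases p; auto)
  have "graph_dist S adj x y \<le> length p - 1"
    unfolding graph_dist_def by (rule Least_le) (use p pos in \<open>cases p; auto\<close>)
  then show "graph_dist S adj x y \<le> height S x y" using p by simp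
  obtain q where "path_in S adj x y q" "length q = graph_dist S adj x y + 1"
    using LeastI_ex[OF ex] unfolding graph_dist_def by blast
  then show "height S x y \<le> graph_dist S adj x y"
    using path_in_imp_nbhd[of S x y q] height_le by fastforce
qed


subsection \<open>Building the complete minor\<close>

text \<open>The invariant of the construction: \<open>m\<close> branch sets \<open>P i\<close> with
  tips \<open>w i\<close>, of which the first \<open>s\<close> already touch all others. Two
  separations are kept. The one by \<open>\<Delta>\<close>, intrinsic to \<open>C\<close>, protects
  the first steps of a descent from a tip; the one by \<open>L\<close> between tips is measured in
  \<open>V\<close>, so it survives passing to a larger subgraph.\<close>

definition partial_minor ::
    "nat \<Rightarrow> nat \<Rightarrow> nat \<Rightarrow> nat \<Rightarrow> 'a set \<Rightarrow> (nat \<Rightarrow> 'a) \<Rightarrow> (nat \<Rightarrow> 'a set) \<Rightarrow> bool" where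
  "partial_minor m s \<Delta> L C w P \<longleftrightarrow>
     (\<forall>i<m. w i \<in> P i \<and> P i \<subseteq> C \<and> walk_connected (P i)) \<and>
     (\<forall>i<m. \<forall>j<m. i \<noteq> j \<longrightarrow>
        P i \<inter> P j = {} \<and> P j \<inter> nbhd C \<Delta> (w i) = {} \<and> w j \<notin> nbhd V L (w i) \<and>
        (i < s \<longrightarrow> (\<exists>x\<in>P i. \<exists>y\<in>P j. adj x y)))"

lemma partial_minorD:
  assumes "partial_minor m s \<Delta> L C w P" "i < m"
  shows "w i \<in> P i" "P i \<subseteq> C" "walk_connected (P i)"
    "j < m \<Longrightarrow> i \<noteq> j \<Longrightarrow> P i \<inter> P j = {}"
    "j < m \<Longrightarrow> i \<noteq> j \<Longrightarrow> p \<in> P j \<Longrightarrow> p \<notin> nbhd C \<Delta> (w i)"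
    "j < m \<Longrightarrow> i \<noteq> j \<Longrightarrow> w j \<notin> nbhd V L (w i)"
    "j < m \<Longrightarrow> i \<noteq> j \<Longrightarrow> i < s \<Longrightarrow> \<exists>x\<in>P i. \<exists>y\<in>P j. adj x y"
  using assms unfolding partial_minor_def by blast+

text \<open>
  From each tip \<open>w i\<close> descend a geodesic of \<open>C\<close> towards the root \<open>x\<close>. Its initial part stays in
  \<open>C'\<close> until it leaves the annulus, hence meets no other \<open>P j\<close>; it is appended to \<open>P i\<close>. All the
  remaining parts together are connected through the root and are appended to \<open>P s\<close>, which
  thereby becomes adjacent to every other branch set. The new tips lie at height
  \<open>a - \<Delta> - 1\<close>, halfway between the annulus and the remaining parts.
\<close>

lemma partial_minor_step:
  assumes pm: "partial_minor m s \<Delta> L C' w P"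
    and C: "C \<subseteq> V" "walk_connected C" "x \<in> C"
    and C': "C' \<subseteq> C" "\<And>u. u \<in> C' \<Longrightarrow> a \<le> height C x u \<and> height C x u < a + \<Delta>"
    and closed: "\<And>u y. a > 0 \<Longrightarrow> u \<in> C' \<Longrightarrow> y \<in> C \<Longrightarrow> adj u y \<Longrightarrow> a \<le> height C x y \<Longrightarrow>
        height C x y < a + \<Delta> \<Longrightarrow> y \<in> C'"
    and m: "2 \<le> m" "s < m" and \<Delta>: "0 < \<Delta>" and L: "14 * \<Delta> \<le> L"
  shows "\<exists>w P. partial_minor m (Suc s) \<Delta> (L - 10 * \<Delta>) C w P"
proof -
  let ?h = "height C x"
  note pmD = partial_minorD[OF pm]
  have comp: "y \<in> comp_of C x" if "y \<in> C" for y
    using C that unfolding walk_connected_def by blast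
  have inV: "y \<in> nbhd V n u" if "y \<in> nbhd C n u" for y n u
    using that nbhd_mono_set[OF C(1)] by blast
  have w: "w i \<in> C'" "w i \<in> C" "a \<le> ?h (w i)" "?h (w i) < a + \<Delta>" if "i < m" for i
    using subsetD[OF pmD(2,1)[OF that]] C' by auto
  have close: "w j \<notin> nbhd V n (w i)" if "i < m" "j < m" "i \<noteq> j" "n \<le> L" for i j n
    using pmD(6)[OF that(1-3)] nbhd_mono[OF that(4)] by blast
  have a: "3 * \<Delta> + 3 \<le> a"
  \<comment> \<open>Were the annulus close to the root, two tips would be joined through the root by
    a walk of length \<open>8 * \<Delta> + 2\<close>, which is at most \<open>L\<close>.\<close>
  proof (rule ccontr)
    assume "\<not> 3 * \<Delta> + 3 \<le> a"
    then have *: "?h (w i) \<le> 4 * \<Delta> + 1" if "i < m" for i using w(4)[OF that] by linarith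
    have *: "w i \<in> nbhd C (4 * \<Delta> + 1) x" if "i < m" for i
      using in_nbhd_iff_height[OF comp[OF w(2)[OF that]]] *[OF that] by blast
    have "w 1 \<in> nbhd C (4 * \<Delta> + 1 + (4 * \<Delta> + 1)) (w 0)"
      by (rule nbhd_trans[OF nbhd_sym[OF C(3) *] *]) (use m in auto)
    moreover have "w 1 \<notin> nbhd V (4 * \<Delta> + 1 + (4 * \<Delta> + 1)) (w 0)"
      by (rule close) (use m \<Delta> L in linarith)+
    ultimately show False using inV by blast
  qed
  \<comment> \<open>The gap of \<open>2 * \<Delta> + 2\<close> below the annulus puts the new tips,
    at height \<open>b + (\<Delta> + 1)\<close>, more than \<open>\<Delta>\<close> away both from
    heights at least \<open>a\<close> and from heights below \<open>b\<close>.\<close>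
  define b where "b = a - (2 * \<Delta> + 2)"
  have b: "0 < b" "b + (2 * \<Delta> + 2) = a" using a by (auto simp: b_def)
  obtain par where par:
    "\<And>y n. y \<in> C \<Longrightarrow> n \<le> ?h y \<Longrightarrow>
      (par ^^ n) y \<in> C \<and> ?h ((par ^^ n) y) = ?h y - n \<and> (par ^^ n) y \<in> nbhd C n y"
    "\<And>y n. y \<in> C \<Longrightarrow> n < ?h y \<Longrightarrow> adj ((par ^^ n) y) ((par ^^ Suc n) y)"
    "\<And>y. y \<in> C \<Longrightarrow> (par ^^ (?h y)) y = x"
    using height_descent[OF C(2,3)] by blast
  define g where "g i n = (par ^^ n) (w i)" for i n
  define H where "H i = ?h (w i)" for i
  define N where "N i = H i - b" for i
  have HN: "N i + b = H i" "N i \<le> 3 * \<Delta> + 1" "a \<le> H i" "H i < a + \<Delta>" "\<Delta> + 1 \<le> N i" if "i < m" for i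
    using w[OF that] b by (auto simp: H_def N_def)
  have g: "g i n \<in> C" "?h (g i n) = H i - n" "g i n \<in> nbhd C n (w i)" if "i < m" "n \<le> H i" for i n
    using par(1)[OF w(2)[OF that(1)]] that unfolding g_def H_def by auto
  have g_adj: "adj (g i n) (g i (Suc n))" if "i < m" "n < H i" for i n
    using par(2)[OF w(2)[OF that(1)]] that unfolding g_def H_def by blast
  have g0: "g i 0 = w i" for i by (simp add: g_def)
  have g_end: "g i (H i) = x" if "i < m" for i
    using par(3)[OF w(2)[OF that]] unfolding g_def H_def by blast
  \<comment> \<open>The descent from tip \<open>i\<close> is cut at height \<open>b\<close>:
    \<open>F i\<close> stays at or above it, and \<open>T\<close> collects everything strictly
    below, so that they are disjoint by height.\<close>
  define F where "F i = g i ` {..N i}" for i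
  define T where "T = (\<Union>i<m. g i ` {N i<..H i})"
  define w' where "w' i = g i (N i - (\<Delta> + 1))" for i
  define P' where "P' i = P i \<union> F i" for i
  define P'' where "P'' i = (if i = s then P' s \<union> T else P' i)" for i
  have F: "p \<in> C" "b \<le> ?h p" "p \<in> nbhd C (3 * \<Delta> + 1) (w i)" if im: "i < m" and pF: "p \<in> F i" for i p
  proof -
    obtain n where n: "n \<le> N i" "p = g i n" using pF unfolding F_def by auto
    have le: "n \<le> H i" using n HN(1)[OF im] by linarith
    show "p \<in> C" "b \<le> ?h p" using g[OF im le] n HN(1)[OF im] by auto
    have "n \<le> 3 * \<Delta> + 1" using n HN(2)[OF im] by linarith
    then show "p \<in> nbhd C (3 * \<Delta> + 1) (w i)"
      using subsetD[OF nbhd_mono g(3)[OF im le]] n(2) by blast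
  qed
  have T: "p \<in> C" "?h p < b" if pT: "p \<in> T" for p
  proof -
    obtain i n where n: "i < m" "N i < n" "n \<le> H i" "p = g i n" using pT unfolding T_def by auto
    then show "p \<in> C" "?h p < b" using g[OF n(1,3)] HN(1)[OF n(1)] b(1) by auto
  qed
  have w': "w' i \<in> F i" "w' i \<in> C" "?h (w' i) = b + (\<Delta> + 1)" "w' i \<in> nbhd C (2 * \<Delta>) (w i)"
    if "i < m" for i
  proof -
    let ?n = "N i - (\<Delta> + 1)"
    have n: "?n \<le> H i" "?n \<le> N i" "?n \<le> 2 * \<Delta>" using HN[OF that] by linarith+
    show "w' i \<in> F i" unfolding w'_def F_def by simp
    show "w' i \<in> C" "?h (w' i) = b + (\<Delta> + 1)"
      using g[OF that n(1)] HN[OF that] unfolding w'_def by auto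
    show "w' i \<in> nbhd C (2 * \<Delta>) (w i)"
      using g(3)[OF that n(1)] nbhd_mono[OF n(3)] unfolding w'_def by blast
  qed
  have hP: "a \<le> ?h p" "p \<in> C" if "i < m" "p \<in> P i" for i p
    using subsetD[OF pmD(2)[OF that(1)] that(2)] C' by auto
  have FP: "F i \<inter> P j = {}" if ij: "i < m" "j < m" "i \<noteq> j" for i j
  proof (rule ccontr)
    assume "F i \<inter> P j \<noteq> {}"
    then obtain n where n: "n \<le> N i" "g i n \<in> P j" unfolding F_def by auto
    have le: "n \<le> H i" using n HN(1)[OF ij(1)] by linarith
    \<comment> \<open>A meeting point lies in \<open>C'\<close>, hence has height at least
      \<open>a\<close> and is reached within \<open>\<Delta>\<close> steps. All earlier points are
      still in the annulus, so \<open>closed\<close> keeps them in \<open>C'\<close>, and the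
      meeting point contradicts the intrinsic separation of \<open>w i\<close> from
      \<open>P j\<close>.\<close>
    have "a \<le> H i - n" using g(2)[OF ij(1) le] hP(1)[OF ij(2) n(2)] by simp
    then have na: "n + a \<le> H i" "n \<le> \<Delta>" using HN(4)[OF ij(1)] a by linarith+
    have "k \<le> n \<Longrightarrow> g i k \<in> C' \<and> g i k \<in> nbhd C' k (w i)" for k
    proof (induction k)
      case 0
      then show ?case using w(1)[OF ij(1)] by (simp add: g0)
    next
      case (Suc k)
      then have IH: "g i k \<in> C'" "g i k \<in> nbhd C' k (w i)" by auto
      have k: "k < H i" "Suc k \<le> H i" using Suc.prems le by linarith+
      have "?h (g i (Suc k)) = H i - Suc k" by (rule g(2)[OF ij(1) k(2)])
      moreover have "a \<le> H i - Suc k" "H i - Suc k < a + \<Delta>"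
        using na Suc.prems HN(4)[OF ij(1)] by linarith+
      ultimately have "g i (Suc k) \<in> C'"
        using closed[OF _ IH(1) g(1)[OF ij(1) k(2)] g_adj[OF ij(1) k(1)]] a by simp
      then show ?case using IH(2) g_adj[OF ij(1) k(1)] by auto
    qed
    then have "g i n \<in> nbhd C' \<Delta> (w i)" using nbhd_mono[OF na(2)] by blast
    then show False using pmD(5)[OF ij n(2)] by blast
  qed
  have FF: "F i \<inter> F j = {}" if ij: "i < m" "j < m" "i \<noteq> j" for i j
  proof (rule ccontr)
    assume "F i \<inter> F j \<noteq> {}"
    then obtain p where p: "p \<in> F i" "p \<in> F j" by blast
    \<comment> \<open>Each initial segment has length at most \<open>3 * \<Delta> + 1\<close>, so a
      common point would bring the two tips too close.\<close>
    have "w j \<in> nbhd C (3 * \<Delta> + 1 + (3 * \<Delta> + 1)) (w i)"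
      using nbhd_trans[OF F(3)[OF ij(1) p(1)] nbhd_sym[OF w(2)[OF ij(2)] F(3)[OF ij(2) p(2)]]] .
    moreover have "w j \<notin> nbhd V (3 * \<Delta> + 1 + (3 * \<Delta> + 1)) (w i)"
      by (rule close[OF ij]) (use \<Delta> L in linarith)
    ultimately show False using inV by blast
  qed
  have P'P': "P' i \<inter> P' j = {}" if ij: "i < m" "j < m" "i \<noteq> j" for i j
    using pmD(4)[OF ij] FP[OF ij] FP[OF ij(2,1)] FF[OF ij] ij(3) unfolding P'_def by blast
  have hP': "b \<le> ?h p" "p \<in> C" if "i < m" and pP: "p \<in> P' i" for i p
  proof -
    consider "p \<in> P i" | "p \<in> F i" using pP unfolding P'_def by blast
    then have "b \<le> ?h p \<and> p \<in> C"
    proof cases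
      case 1
      then show ?thesis using hP[OF \<open>i < m\<close> 1] b(2) by linarith
    next
      case 2
      then show ?thesis using F[OF \<open>i < m\<close> 2] by blast
    qed
    then show "b \<le> ?h p" "p \<in> C" by auto
  qed
  have TP': "T \<inter> P' i = {}" if "i < m" for i
    using T(2) hP'(1)[OF that] by (meson disjoint_iff leD)
  have disj: "P'' i \<inter> P'' j = {}" if ij: "i < m" "j < m" "i \<noteq> j" for i j
    using P'P'[OF ij] TP'[OF ij(1)] TP'[OF ij(2)] ij(3) unfolding P''_def by auto
  have connF: "walk_connected (F i)" if "i < m" for i
  proof (rule walk_connectedI[of "g i 0"])
    show "F i \<subseteq> comp_of (F i) (g i 0)"
    proof
      fix p assume "p \<in> F i"
      then obtain n where n: "n \<le> N i" "p = g i n" unfolding F_def by auto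
      show "p \<in> comp_of (F i) (g i 0)" unfolding n(2)
        by (rule chain_in_comp_of) (use n HN(1)[OF that] g_adj[OF that] in \<open>auto simp: F_def\<close>)
    qed
  qed (simp add: F_def)
  have connP': "walk_connected (P' i)" if "i < m" for i
    unfolding P'_def
    by (rule walk_connected_Un[OF pmD(3)[OF that] connF[OF that] pmD(1)[OF that]])
      (auto simp: F_def g0 intro!: image_eqI[where x = 0])
  have xT: "x \<in> T"
  proof -
    have "N 0 < H 0" using HN(1)[of 0] b(1) m by linarith
    then show ?thesis unfolding T_def using g_end[of 0] m by (auto intro!: bexI[of _ 0] image_eqI[of _ _ "H 0"])
  qed
  have connT: "walk_connected T"
  proof (rule walk_connectedI[OF xT], rule subsetI)
    fix p assume "p \<in> T"
    then obtain i n where n: "i < m" "N i < n" "n \<le> H i" "p = g i n" unfolding T_def by auto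
    have "g i (H i) \<in> comp_of T (g i n)"
      by (rule chain_in_comp_of) (use n g_adj[OF n(1)] in \<open>auto simp: T_def intro!: bexI[of _ i]\<close>)
    then show "p \<in> comp_of T x"
      using comp_of_sym[OF \<open>p \<in> T\<close>] g_end[OF n(1)] n(4) by simp
  qed
  have link: "g i (N i) \<in> P' i" "g i (Suc (N i)) \<in> T" "adj (g i (N i)) (g i (Suc (N i)))"
    if "i < m" for i
    using HN(1)[OF that] b(1) g_adj[OF that, of "N i"] that
    by (auto simp: P'_def F_def T_def intro!: bexI[of _ i])
  have conn: "walk_connected (P'' i)" if "i < m" for i
    using walk_connected_Un_adj[OF connP'[OF m(2)] connT link[OF m(2)]] connP'[OF that]
    unfolding P''_def by simp
  have sub: "P' i \<subseteq> P'' i" for i unfolding P''_def by auto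
  have subC: "P'' i \<subseteq> C" if "i < m" for i
    using hP'(2)[OF that] hP'(2)[OF m(2)] T(1) unfolding P''_def by auto
  have sep: "p \<notin> nbhd C \<Delta> (w' i)" if ij: "i < m" "j < m" "i \<noteq> j" and p: "p \<in> P'' j" for i j p
  proof
    assume near: "p \<in> nbhd C \<Delta> (w' i)"
    have up: "?h p \<le> ?h (w' i) + \<Delta>" by (rule height_nbhd[OF comp[OF w'(2)[OF ij(1)]] near])
    have pC: "p \<in> C" using subC[OF ij(2)] p by blast
    have down: "?h (w' i) \<le> ?h p + \<Delta>"
      by (rule height_nbhd[OF comp[OF pC] nbhd_sym[OF w'(2)[OF ij(1)] near]])
    \<comment> \<open>The old branch sets are too high and \<open>T\<close> is too low to be near
      the new tip; only \<open>F j\<close> can share its height, and there the distance between the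
      old tips decides.\<close>
    consider "p \<in> P j" | "p \<in> F j" | "p \<in> T" using p unfolding P''_def P'_def by (auto split: if_splits)
    then show False
    proof cases
      case 1
      then show False using hP(1)[OF ij(2) 1] up w'(3)[OF ij(1)] b by linarith
    next
      case 2
      have "w j \<in> nbhd C (2 * \<Delta> + \<Delta> + (3 * \<Delta> + 1)) (w i)"
        using nbhd_trans[OF nbhd_trans[OF w'(4)[OF ij(1)] near]
            nbhd_sym[OF w(2)[OF ij(2)] F(3)[OF ij(2) 2]]] .
      moreover have "w j \<notin> nbhd V (2 * \<Delta> + \<Delta> + (3 * \<Delta> + 1)) (w i)"
        by (rule close[OF ij]) (use \<Delta> L in linarith)
      ultimately show False using inV by blast
    next
      case 3
      then show False using T(2)[OF 3] down w'(3)[OF ij(1)] by linarith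
    qed
  qed
  have far: "w' j \<notin> nbhd V (L - 10 * \<Delta>) (w' i)" if ij: "i < m" "j < m" "i \<noteq> j" for i j
  proof
    assume near: "w' j \<in> nbhd V (L - 10 * \<Delta>) (w' i)"
    \<comment> \<open>Each tip has moved by at most \<open>2 * \<Delta>\<close>, which the loss of
      \<open>10 * \<Delta>\<close> in \<open>L\<close> covers.\<close>
    have "w j \<in> nbhd V (2 * \<Delta> + (L - 10 * \<Delta>) + 2 * \<Delta>) (w i)"
      using nbhd_trans[OF nbhd_trans[OF inV[OF w'(4)[OF ij(1)]] near]
          inV[OF nbhd_sym[OF w(2)[OF ij(2)] w'(4)[OF ij(2)]]]] .
    moreover have "w j \<notin> nbhd V (2 * \<Delta> + (L - 10 * \<Delta>) + 2 * \<Delta>) (w i)"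
      by (rule close[OF ij]) (use L in linarith)
    ultimately show False by blast
  qed
  have edge: "\<exists>u\<in>P'' i. \<exists>v\<in>P'' j. adj u v" if ij: "i < m" "j < m" "i \<noteq> j" and "i < Suc s" for i j
  proof (cases "i = s")
    case True
    then have "g j (Suc (N j)) \<in> P'' i" "g j (N j) \<in> P'' j"
      using link[OF ij(2)] sub unfolding P''_def by auto
    then show ?thesis using adj_sym[OF link(3)[OF ij(2)]] by blast
  next
    case False
    then have "i < s" using that by simp
    then obtain u v where "u \<in> P i" "v \<in> P j" "adj u v" using pmD(7)[OF ij] by blast
    then show ?thesis using sub unfolding P'_def by blast
  qed
  have tip: "w' i \<in> P'' i" if "i < m" for i
    using w'(1)[OF that] sub unfolding P'_def by blast
  have "partial_minor m (Suc s) \<Delta> (L - 10 * \<Delta>) C w' P''"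
    unfolding partial_minor_def
  proof (intro conjI allI impI)
    fix i j assume ij: "i < m" "j < m" "i \<noteq> j"
    show "P'' j \<inter> nbhd C \<Delta> (w' i) = {}" using sep[OF ij] by blast
  qed (simp_all add: tip subC conn disj far edge)
  then show ?thesis by blast
qed


lemma partial_minor_imp_complete_minor:
  assumes "partial_minor m m \<Delta> L V w P"
  shows "has_complete_minor m V adj"
  unfolding has_complete_minor_def connected_on_iff_walk_connected
proof (intro exI[of _ P] conjI allI impI)
  fix i assume "i < m"
  then show "P i \<noteq> {}" "P i \<subseteq> V" "walk_connected (P i)" using partial_minorD[OF assms] by blast+
next
  fix i j assume "i < m" "j < m" "i \<noteq> j"
  then show "P i \<inter> P j = {}" "\<exists>x\<in>P i. \<exists>y\<in>P j. adj x y" using partial_minorD[OF assms] by metis+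
qed

subsection \<open>Chopping into annuli\<close>

text \<open>The root is chosen from the set \<open>C\<close> alone, so all vertices of one cluster
  measure their heights from the same root; this is what makes the clusters a partition. The offset
  \<open>\<sigma>\<close> shifts the boundaries of the annuli.\<close>

definition annulus :: "nat \<Rightarrow> nat \<Rightarrow> 'a set \<Rightarrow> 'a \<Rightarrow> 'a set" where
  "annulus \<Delta> \<sigma> C v =
     {u \<in> C. (height C (SOME x. x \<in> C) u + \<sigma>) div \<Delta> = (height C (SOME x. x \<in> C) v + \<sigma>) div \<Delta>}"

text \<open>The head of the list is the offset of the last cut, so induction on the list undoes the
  last cut first.\<close>

primrec cluster :: "nat \<Rightarrow> nat list \<Rightarrow> 'a \<Rightarrow> 'a set" where
  "cluster \<Delta> [] v = V"
| "cluster \<Delta> (\<sigma> # \<sigma>s) v = comp_of (annulus \<Delta> \<sigma> (cluster \<Delta> \<sigma>s v) v) v"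

lemma cluster_self: "v \<in> V \<Longrightarrow> v \<in> cluster \<Delta> \<sigma>s v"
  by (cases \<sigma>s) (auto simp: comp_of_self)

lemma annulus_self: "v \<in> V \<Longrightarrow> v \<in> annulus \<Delta> \<sigma> (cluster \<Delta> \<sigma>s v) v"
  unfolding annulus_def by (simp add: cluster_self)

lemma annulus_subset: "annulus \<Delta> \<sigma> C v \<subseteq> C"
  unfolding annulus_def by blast

lemma cluster_Cons_subset: "v \<in> V \<Longrightarrow> cluster \<Delta> (\<sigma> # \<sigma>s) v \<subseteq> annulus \<Delta> \<sigma> (cluster \<Delta> \<sigma>s v) v"
  by (simp add: comp_of_subset annulus_self)

lemma cluster_subset: "v \<in> V \<Longrightarrow> cluster \<Delta> \<sigma>s v \<subseteq> V"
proof (induction \<sigma>s)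
  case (Cons \<sigma> \<sigma>s)
  then show ?case using cluster_Cons_subset annulus_subset by (meson order_trans)
qed simp

lemma walk_connected_cluster: "walk_connected V \<Longrightarrow> v \<in> V \<Longrightarrow> walk_connected (cluster \<Delta> \<sigma>s v)"
  by (cases \<sigma>s) (auto intro: walk_connected_comp_of annulus_self)

lemma cluster_eq:
  assumes "v \<in> V"
  shows "u \<in> cluster \<Delta> \<sigma>s v \<Longrightarrow> cluster \<Delta> \<sigma>s u = cluster \<Delta> \<sigma>s v"
proof (induction \<sigma>s)
  case (Cons \<sigma> \<sigma>s)
  let ?C = "cluster \<Delta> \<sigma>s v"
  have u: "u \<in> annulus \<Delta> \<sigma> ?C v" using Cons.prems cluster_Cons_subset[OF assms] by blast
  then have eq: "cluster \<Delta> \<sigma>s u = ?C" using Cons.IH unfolding annulus_def by blast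
  have "annulus \<Delta> \<sigma> ?C u = annulus \<Delta> \<sigma> ?C v" using u unfolding annulus_def by auto
  then show ?case
    using comp_of_eq[OF annulus_self[OF assms]] Cons.prems by (simp add: eq)
qed simp

text \<open>Undoing one cut applies \<open>partial_minor_step\<close> once: it completes one more
  branch set and costs \<open>10 * \<Delta>\<close> of the separation, of which
  \<open>14 * \<Delta>\<close> must be left before each application.\<close>

lemma partial_minor_cluster:
  assumes V: "walk_connected V" "v \<in> V" and m: "2 \<le> m" and \<Delta>: "0 < \<Delta>"
  shows "partial_minor m s \<Delta> L (cluster \<Delta> \<sigma>s v) w P \<Longrightarrow> s + length \<sigma>s \<le> m \<Longrightarrow>
    14 * \<Delta> + 10 * \<Delta> * length \<sigma>s \<le> L \<Longrightarrow>
    \<exists>L' w' P'. partial_minor m (s + length \<sigma>s) \<Delta> L' V w' P'"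
proof (induction \<sigma>s arbitrary: s L w P)
  case Nil
  then show ?case by auto
next
  case (Cons \<sigma> \<sigma>s)
  define C where "C = cluster \<Delta> \<sigma>s v"
  define x where "x = (SOME x. x \<in> C)"
  define q where "q = (height C x v + \<sigma>) div \<Delta>"
  \<comment> \<open>The lower end of the annulus. The subtraction truncates when the annulus around
    the root is cut short, and then the annulus may be thinner than the heights from
    \<open>0\<close> to \<open>\<Delta>\<close>; for this reason closure is claimed only for
    \<open>a > 0\<close>.\<close>
  define a where "a = q * \<Delta> - \<sigma>"
  have ann: "annulus \<Delta> \<sigma> C v = {u \<in> C. (height C x u + \<sigma>) div \<Delta> = q}"
    unfolding annulus_def x_def q_def ..
  have x: "x \<in> C" unfolding x_def C_def by (rule someI[of _ v]) (rule cluster_self[OF V(2)])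
  have iff: "(h + \<sigma>) div \<Delta> = q \<longleftrightarrow> q * \<Delta> \<le> h + \<sigma> \<and> h + \<sigma> < q * \<Delta> + \<Delta>" for h
    using \<Delta> by (auto simp: div_nat_eqI algebra_simps dividend_less_times_div)
  have sub: "cluster \<Delta> (\<sigma> # \<sigma>s) v \<subseteq> annulus \<Delta> \<sigma> C v"
    unfolding C_def by (rule cluster_Cons_subset[OF V(2)])
  have "\<exists>w P. partial_minor m (Suc s) \<Delta> (L - 10 * \<Delta>) C w P"
  proof (rule partial_minor_step[OF Cons.prems(1)])
    show "C \<subseteq> V" "walk_connected C" "x \<in> C"
      using cluster_subset walk_connected_cluster V x unfolding C_def by auto
    show "cluster \<Delta> (\<sigma> # \<sigma>s) v \<subseteq> C" using sub annulus_subset by blast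
    show "a \<le> height C x u \<and> height C x u < a + \<Delta>" if "u \<in> cluster \<Delta> (\<sigma> # \<sigma>s) v" for u
    proof -
      have "(height C x u + \<sigma>) div \<Delta> = q" using that sub unfolding ann by blast
      then show ?thesis unfolding iff a_def by linarith
    qed
    show "y \<in> cluster \<Delta> (\<sigma> # \<sigma>s) v"
      if "a > 0" "u \<in> cluster \<Delta> (\<sigma> # \<sigma>s) v" "y \<in> C" "adj u y" "a \<le> height C x y"
        "height C x y < a + \<Delta>" for u y
    proof -
      have "(height C x y + \<sigma>) div \<Delta> = q" unfolding iff using that unfolding a_def by linarith
      then have "y \<in> annulus \<Delta> \<sigma> C v" using that unfolding ann by blast
      then show ?thesis using comp_of_adj[OF _ \<open>adj u y\<close>] that(2) by (simp add: C_def)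
    qed
  qed (use m \<Delta> Cons.prems in auto)
  then obtain w' P' where "partial_minor m (Suc s) \<Delta> (L - 10 * \<Delta>) C w' P'" by blast
  then show ?case using Cons.IH[of "Suc s" "L - 10 * \<Delta>" w' P'] Cons.prems unfolding C_def by auto
qed

text \<open>In a cluster with a vertex too far from \<open>v\<close>, the distance from
  \<open>v\<close> in \<open>V\<close> takes all the values \<open>i * (L + 1)\<close> with
  \<open>i < r\<close>. The vertices found there are pairwise more than \<open>L\<close> apart, so
  as singletons they start a partial minor, which becomes complete once all \<open>r\<close> cuts
  are undone.\<close>

lemma cluster_weak_diameter:
  assumes V: "walk_connected V" "v \<in> V" and r: "2 \<le> r" and \<Delta>: "0 < \<Delta>"
    and nominor: "\<not> has_complete_minor r V adj"
    and u: "u \<in> cluster \<Delta> \<sigma>s v" and len: "length \<sigma>s = r"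
  shows "u \<in> nbhd V (r * (14 * \<Delta> + 10 * \<Delta> * r + 1)) v"
proof (rule ccontr)
  define L where "L = 14 * \<Delta> + 10 * \<Delta> * r"
  let ?C = "cluster \<Delta> \<sigma>s v"
  assume "u \<notin> nbhd V (r * (14 * \<Delta> + 10 * \<Delta> * r + 1)) v"
  then have far: "u \<notin> nbhd V (r * (L + 1)) v" by (simp add: L_def)
  have CV: "?C \<subseteq> V" by (rule cluster_subset[OF V(2)])
  have comp: "y \<in> comp_of V v" if "y \<in> V" for y
    using V that unfolding walk_connected_def by blast
  have hu: "r * (L + 1) < height V v u"
    using far in_nbhd_iff_height[OF comp] u CV by (meson not_le subsetD)
  have "u \<in> comp_of ?C v"
    using walk_connected_cluster[OF V] cluster_self[OF V(2)] u unfolding walk_connected_def by blast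
  then obtain n where n: "u \<in> nbhd ?C n v" unfolding comp_of_def by blast
  have "\<exists>z\<in>?C. height V v z = i * (L + 1)" if "i < r" for i
  proof (rule nbhd_intermediate_value[OF _ cluster_self[OF V(2)] n])
    show "height V v z \<le> height V v y + 1" if "y \<in> ?C" "z \<in> ?C" "adj y z" for y z
      using height_adj[OF comp] that CV by blast
    have "i * (L + 1) \<le> r * (L + 1)" using that by (intro mult_right_mono) auto
    then show "i * (L + 1) \<le> height V v u" using hu by linarith
  qed (simp add: height_self)
  then obtain w where w: "\<And>i. i < r \<Longrightarrow> w i \<in> ?C \<and> height V v (w i) = i * (L + 1)" by metis
  have up: "w j \<notin> nbhd V L (w i)" if "i < r" "j < r" "i < j" for i j
  proof
    assume "w j \<in> nbhd V L (w i)"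
    then have "j * (L + 1) \<le> i * (L + 1) + L"
      using height_nbhd[OF comp, of "w i" "w j" L] w[OF that(1)] w[OF that(2)] CV by auto
    moreover have "(i + 1) * (L + 1) \<le> j * (L + 1)" using that by (intro mult_right_mono) auto
    ultimately show False by simp
  qed
  have sep: "w j \<notin> nbhd V L (w i)" if "i < r" "j < r" "i \<noteq> j" for i j
    using up[OF that(1,2)] up[OF that(2,1)] nbhd_sym[of "w i" V "w j" L] w[OF that(1)] CV that(3)
    by (meson linorder_neqE_nat subsetD)
  have "partial_minor r 0 \<Delta> L ?C w (\<lambda>i. {w i})"
    unfolding partial_minor_def
  proof (intro conjI allI impI)
    fix i assume "i < r"
    then show "{w i} \<subseteq> ?C" using w by blast
    show "walk_connected {w i}" unfolding walk_connected_def by (simp add: comp_of_self)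
  next
    fix i j assume ij: "i < r" "j < r" "i \<noteq> j"
    show "w j \<notin> nbhd V L (w i)" by (rule sep[OF ij])
    show "{w i} \<inter> {w j} = {}" using sep[OF ij] nbhd_self by auto
    have "nbhd ?C \<Delta> (w i) \<subseteq> nbhd V L (w i)"
      using nbhd_mono_set[OF CV] nbhd_mono[of \<Delta> L V "w i"] by (force simp: L_def)
    then show "{w j} \<inter> nbhd ?C \<Delta> (w i) = {}" using sep[OF ij] by blast
  qed auto
  then have "\<exists>L' w' P'. partial_minor r (0 + length \<sigma>s) \<Delta> L' V w' P'"
    by (rule partial_minor_cluster[OF V r \<Delta>]) (auto simp: len L_def)
  then show False using partial_minor_imp_complete_minor nominor len by auto
qed

subsection \<open>Counting the offsets that separate two vertices\<close>

text \<open>Consecutive numbers are split only when a multiple of \<open>\<Delta>\<close> falls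
  exactly at the shifted larger one, which fixes the residue of the offset modulo
  \<open>\<Delta>\<close>.\<close>

lemma card_div_neq_le_1:
  fixes a b \<Delta> :: nat
  assumes "a \<le> b + 1" "b \<le> a + 1"
  shows "card {\<sigma>. \<sigma> < \<Delta> \<and> (a + \<sigma>) div \<Delta> \<noteq> (b + \<sigma>) div \<Delta>} \<le> 1"
proof -
  have eq: "\<sigma> = \<tau>"
    if "\<sigma> < \<Delta>" "\<tau> < \<Delta>" "(c + \<sigma>) div \<Delta> \<noteq> (Suc c + \<sigma>) div \<Delta>" "(c + \<tau>) div \<Delta> \<noteq> (Suc c + \<tau>) div \<Delta>"
    for c \<sigma> \<tau> :: nat
  proof -
    have "Suc (c + \<sigma>) mod \<Delta> = Suc (c + \<tau>) mod \<Delta>"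
      using that(3,4) by (simp add: div_Suc split: if_splits)
    then have "[Suc c + \<sigma> = Suc c + \<tau>] (mod \<Delta>)" by (simp add: cong_def)
    then show ?thesis using that(1,2) by (simp only: cong_add_lcancel_nat) (simp add: cong_def)
  qed
  consider "a = b" | "a = Suc b" | "b = Suc a" using assms by linarith
  then have "\<sigma> = \<tau>" if "\<sigma> < \<Delta>" "\<tau> < \<Delta>" "(a + \<sigma>) div \<Delta> \<noteq> (b + \<sigma>) div \<Delta>"
      "(a + \<tau>) div \<Delta> \<noteq> (b + \<tau>) div \<Delta>" for \<sigma> \<tau>
    by cases (use that eq in metis)+
  then show ?thesis by (subst One_nat_def, subst card_le_Suc0_iff_eq) auto
qed

definition offsets :: "nat \<Rightarrow> nat \<Rightarrow> nat list set" where
  "offsets \<Delta> k = {\<sigma>s. set \<sigma>s \<subseteq> {..<\<Delta>} \<and> length \<sigma>s = k}"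

lemma finite_offsets: "finite (offsets \<Delta> k)"
  unfolding offsets_def by (rule finite_lists_length_eq) simp

lemma card_offsets: "card (offsets \<Delta> k) = \<Delta> ^ k"
  unfolding offsets_def by (simp add: card_lists_length_eq)

text \<open>Its cardinality divided by \<open>\<Delta> ^ k\<close> is the probability that uniformly
  random offsets separate \<open>u\<close> and \<open>v\<close>.\<close>

definition separating :: "nat \<Rightarrow> nat \<Rightarrow> 'a \<Rightarrow> 'a \<Rightarrow> nat list set" where
  "separating \<Delta> k u v = {\<sigma>s \<in> offsets \<Delta> k. cluster \<Delta> \<sigma>s u \<noteq> cluster \<Delta> \<sigma>s v}"

lemma finite_separating: "finite (separating \<Delta> k u v)"
  unfolding separating_def using finite_offsets by simp

text \<open>A union bound over the cuts, stated without division: an edge that has survived so far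
  is cut by at most one of the \<open>\<Delta>\<close> next offsets.\<close>

lemma card_separating_adj:
  assumes V: "walk_connected V" and uv: "adj u v"
  shows "card (separating \<Delta> k u v) * \<Delta> \<le> k * \<Delta> ^ k"
proof (induction k)
  case 0
  have "separating \<Delta> 0 u v = {}" by (auto simp: separating_def offsets_def)
  then show ?case by simp
next
  case (Suc k)
  have uV: "u \<in> V" "v \<in> V" using uv adj_in_V by auto
  define cut where "cut \<sigma>s = {\<sigma>. \<sigma> < \<Delta> \<and> cluster \<Delta> \<sigma>s u = cluster \<Delta> \<sigma>s v \<and>
      cluster \<Delta> (\<sigma> # \<sigma>s) u \<noteq> cluster \<Delta> (\<sigma> # \<sigma>s) v}" for \<sigma>s
  have cut: "card (cut \<sigma>s) \<le> 1" for \<sigma>s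
  proof (cases "cluster \<Delta> \<sigma>s u = cluster \<Delta> \<sigma>s v")
    case True
    define C where "C = cluster \<Delta> \<sigma>s v"
    define x where "x = (SOME x. x \<in> C)"
    have C: "u \<in> C" "v \<in> C" "walk_connected C"
      using cluster_self[OF uV(1), of \<Delta> \<sigma>s] cluster_self[OF uV(2), of \<Delta> \<sigma>s] True
        walk_connected_cluster[OF V uV(2)] unfolding C_def by auto
    have "x \<in> C" unfolding x_def by (rule someI) (rule C(2))
    then have comp: "u \<in> comp_of C x" "v \<in> comp_of C x" using C unfolding walk_connected_def by blast+
    have "cut \<sigma>s \<subseteq> {\<sigma>. \<sigma> < \<Delta> \<and> (height C x u + \<sigma>) div \<Delta> \<noteq> (height C x v + \<sigma>) div \<Delta>}"
    proof (rule subsetI, rule ccontr)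
      fix \<sigma> assume \<sigma>: "\<sigma> \<in> cut \<sigma>s"
        "\<sigma> \<notin> {\<sigma>. \<sigma> < \<Delta> \<and> (height C x u + \<sigma>) div \<Delta> \<noteq> (height C x v + \<sigma>) div \<Delta>}"
      \<comment> \<open>If both ends lie in the same annulus, the edge between them puts them in the
        same component of it.\<close>
      then have "u \<in> annulus \<Delta> \<sigma> C v" using C unfolding cut_def annulus_def x_def by auto
      then have "u \<in> cluster \<Delta> (\<sigma> # \<sigma>s) v"
        using comp_of_adj[OF comp_of_self adj_sym[OF uv]] by (simp add: C_def)
      then show False using cluster_eq[OF uV(2)] \<sigma>(1) unfolding cut_def by blast
    qed
    moreover have "card {\<sigma>. \<sigma> < \<Delta> \<and> (height C x u + \<sigma>) div \<Delta> \<noteq> (height C x v + \<sigma>) div \<Delta>} \<le> 1"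
      by (rule card_div_neq_le_1) (use height_adj comp uv adj_sym C in blast)+
    ultimately show ?thesis by (rule order_trans[OF card_mono, rotated]) simp
  qed (simp add: cut_def)
  have fin: "finite (cut \<sigma>s)" for \<sigma>s unfolding cut_def by simp
  \<comment> \<open>Either the earlier cuts already separate the ends, with the last offset
    arbitrary, or the last cut is the first to do so.\<close>
  have "separating \<Delta> (Suc k) u v \<subseteq>
      (\<lambda>(\<sigma>s, \<sigma>). \<sigma> # \<sigma>s) ` (separating \<Delta> k u v \<times> {..<\<Delta>} \<union> (SIGMA \<sigma>s:offsets \<Delta> k. cut \<sigma>s))"
  proof
    fix \<sigma>s' assume *: "\<sigma>s' \<in> separating \<Delta> (Suc k) u v"
    then obtain \<sigma> \<sigma>s where \<sigma>s': "\<sigma>s' = \<sigma> # \<sigma>s"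
      unfolding separating_def offsets_def by (cases \<sigma>s') auto
    have "(\<sigma>s, \<sigma>) \<in> separating \<Delta> k u v \<times> {..<\<Delta>} \<union> (SIGMA \<sigma>s:offsets \<Delta> k. cut \<sigma>s)"
      using * unfolding \<sigma>s' separating_def offsets_def cut_def by auto
    then show "\<sigma>s' \<in> (\<lambda>(\<sigma>s, \<sigma>). \<sigma> # \<sigma>s) ` (separating \<Delta> k u v \<times> {..<\<Delta>} \<union> (SIGMA \<sigma>s:offsets \<Delta> k. cut \<sigma>s))"
      unfolding \<sigma>s' by (rule rev_image_eqI) simp
  qed
  then have "card (separating \<Delta> (Suc k) u v) \<le>
      card (separating \<Delta> k u v \<times> {..<\<Delta>} \<union> (SIGMA \<sigma>s:offsets \<Delta> k. cut \<sigma>s))"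
    by (rule surj_card_le[rotated]) (simp add: finite_separating finite_offsets fin)
  also have "\<dots> \<le> card (separating \<Delta> k u v \<times> {..<\<Delta>}) + card (SIGMA \<sigma>s:offsets \<Delta> k. cut \<sigma>s)"
    by (rule card_Un_le)
  also have "card (separating \<Delta> k u v \<times> {..<\<Delta>}) = card (separating \<Delta> k u v) * \<Delta>"
    by (simp add: card_cartesian_product)
  also have "card (SIGMA \<sigma>s:offsets \<Delta> k. cut \<sigma>s) = (\<Sum>\<sigma>s\<in>offsets \<Delta> k. card (cut \<sigma>s))"
    by (rule card_SigmaI) (auto simp: finite_offsets fin)
  also have "\<dots> \<le> (\<Sum>\<sigma>s\<in>offsets \<Delta> k. 1)" by (rule sum_mono) (rule cut)
  also have "\<dots> = \<Delta> ^ k" by (simp add: card_offsets)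
  finally have "card (separating \<Delta> (Suc k) u v) \<le> card (separating \<Delta> k u v) * \<Delta> + \<Delta> ^ k" by simp
  then have "card (separating \<Delta> (Suc k) u v) \<le> k * \<Delta> ^ k + \<Delta> ^ k" using Suc.IH by linarith
  then have "card (separating \<Delta> (Suc k) u v) * \<Delta> \<le> (k * \<Delta> ^ k + \<Delta> ^ k) * \<Delta>" by (rule mult_right_mono) simp
  then show ?case by (simp add: algebra_simps)
qed

text \<open>Offsets that separate the ends of a walk separate the ends of one of its edges.\<close>

lemma card_separating:
  assumes V: "walk_connected V"
  shows "y \<in> nbhd V n x \<Longrightarrow> card (separating \<Delta> k x y) * \<Delta> \<le> n * (k * \<Delta> ^ k)"
proof (induction n arbitrary: y)
  case 0
  then have "separating \<Delta> k x y = {}" by (auto simp: separating_def)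
  then show ?case by simp
next
  case (Suc n)
  show ?case
  proof (cases "y \<in> nbhd V n x")
    case True
    then show ?thesis using Suc.IH[OF True] by simp
  next
    case False
    then obtain u where u: "u \<in> nbhd V n x" "adj u y" using Suc.prems by auto
    have "separating \<Delta> k x y \<subseteq> separating \<Delta> k x u \<union> separating \<Delta> k u y"
      unfolding separating_def by auto
    then have "card (separating \<Delta> k x y) \<le> card (separating \<Delta> k x u) + card (separating \<Delta> k u y)"
      using card_mono[of "separating \<Delta> k x u \<union> separating \<Delta> k u y"] card_Un_le finite_separating
      by (meson finite_UnI order_trans)
    then have "card (separating \<Delta> k x y) * \<Delta> \<le>
        card (separating \<Delta> k x u) * \<Delta> + card (separating \<Delta> k u y) * \<Delta>"
      by (metis add_mult_distrib mult_le_mono1)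
    then show ?thesis using Suc.IH[OF u(1)] card_separating_adj[OF V u(2), of \<Delta> k] by simp
  qed
qed

text \<open>Countability allows clusters to be named by natural numbers. Balls are finite by local
  finiteness, and those around one vertex exhaust a connected graph.\<close>

lemma countable_vertices:
  assumes "walk_connected V" "locally_finite_graph V adj"
  shows "countable V"
proof (cases "V = {}")
  case False
  then obtain x where x: "x \<in> V" by blast
  have "finite (nbhd V n x)" for n
  proof (induction n)
    case (Suc n)
    have "finite (\<Union>u\<in>nbhd V n x. {y \<in> V. adj u y})"
      using Suc assms(2) nbhd_subset[OF x] unfolding locally_finite_graph_def by blast
    moreover have "nbhd V (Suc n) x = nbhd V n x \<union> (\<Union>u\<in>nbhd V n x. {y \<in> V. adj u y})" by auto
    ultimately show ?case using Suc by simp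
  qed simp
  then have "countable (comp_of V x)" unfolding comp_of_def by (simp add: countable_finite)
  then show ?thesis using assms(1) x unfolding walk_connected_def by (meson countable_subset)
qed simp

end

subsection \<open>Embedding weighted partitions into $L_1[0,1]$\<close>

text \<open>These intervals partition the unit interval without \<open>0\<close>, giving one piece
  of positive length for each coordinate of a sequence.\<close>

definition cell :: "nat \<Rightarrow> real set" where
  "cell j = {1 / (real j + 2)<..1 / (real j + 1)}"

definition cell_length :: "nat \<Rightarrow> real" where
  "cell_length j = 1 / (real j + 1) - 1 / (real j + 2)"

lemma cell_length_pos: "0 < cell_length j"
  unfolding cell_length_def by (simp add: divide_strict_left_mono)

lemma cell_inj: "t \<in> cell i \<Longrightarrow> t \<in> cell j \<Longrightarrow> i = j"
proof (induction i j rule: linorder_wlog)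
  case (le i j)
  show ?case
  proof (rule ccontr)
    assume "i \<noteq> j"
    then have "real i + 2 \<le> real j + 1" using le by linarith
    then have "1 / (real j + 1) \<le> 1 / (real i + 2)" by (intro divide_left_mono) auto
    then show False using le unfolding cell_def by auto
  qed
qed auto

lemma cell_subset: "cell j \<subseteq> {0..1}"
proof
  fix x assume "x \<in> cell j"
  then have "1 / (real j + 2) < x" "x \<le> 1 / (real j + 1)" unfolding cell_def by auto
  moreover have "0 \<le> 1 / (real j + 2)" "1 / (real j + 1) \<le> 1" by auto
  ultimately have "0 \<le> x" "x \<le> 1" by linarith+
  then show "x \<in> {0..1}" by simp
qed

definition step_fun :: "(nat \<Rightarrow> real) \<Rightarrow> real \<Rightarrow> real" where
  "step_fun c t = (\<Sum>j. c j * indicat_real (cell j) t)"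

text \<open>The index \<open>k\<close> depends on \<open>t\<close> only and serves all coefficient
  sequences, so different step functions can be compared at the same point.\<close>

lemma step_fun_cases:
  obtains k where "\<And>c. step_fun c t = c k" "\<And>j. indicat_real (cell j) t = of_bool (j = k)"
  | "\<And>c. step_fun c t = 0" "\<And>j. indicat_real (cell j) t = 0"
proof (cases "\<exists>k. t \<in> cell k")
  case True
  then obtain k where k: "t \<in> cell k" by blast
  then have ind: "indicat_real (cell j) t = of_bool (j = k)" for j
    using cell_inj by (auto simp: indicator_def)
  have "step_fun c t = c k" for c
    unfolding step_fun_def by (subst suminf_finite[of "{k}"]) (auto simp: ind)
  then show ?thesis using ind that(1) by blast
next
  case False
  then have ind: "indicat_real (cell j) t = 0" for j by (auto simp: indicator_def)
  then have "step_fun c t = 0" for c unfolding step_fun_def by simp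
  then show ?thesis using ind that(2) by blast
qed

lemma cell_integral:
  "integrable (lebesgue_on {0..1}) (\<lambda>t. c * indicat_real (cell j) t)"
  "(\<integral>t. c * indicat_real (cell j) t \<partial>lebesgue_on {0..1}) = c * cell_length j"
proof -
  have le: "1 / (real j + 2) \<le> 1 / (real j + 1)" by (intro divide_left_mono) auto
  have "cell j \<in> sets lebesgue" "emeasure lebesgue (cell j) = ennreal (cell_length j)"
    unfolding cell_def cell_length_def using le by auto
  then have m: "cell j \<in> sets (lebesgue_on {0..1})"
    "emeasure (lebesgue_on {0..1}) (cell j) = ennreal (cell_length j)"
    using cell_subset[of j] by (auto simp: sets_restrict_space_iff emeasure_restrict_space)
  then have int: "integrable (lebesgue_on {0..1}) (indicat_real (cell j))" by simp
  then show "integrable (lebesgue_on {0..1}) (\<lambda>t. c * indicat_real (cell j) t)" by simp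
  have "measure (lebesgue_on {0..1}) (cell j) = cell_length j"
    using m(2) cell_length_pos[of j] by (simp add: measure_def)
  then show "(\<integral>t. c * indicat_real (cell j) t \<partial>lebesgue_on {0..1}) = c * cell_length j"
    using m(1) cell_subset[of j] by (simp add: Int_absorb2)
qed

lemma step_fun_integral:
  assumes "summable (\<lambda>j. \<bar>c j\<bar> * cell_length j)"
  shows "integrable (lebesgue_on {0..1}) (step_fun c)"
    and "(\<integral>t. step_fun c t \<partial>lebesgue_on {0..1}) = (\<Sum>j. c j * cell_length j)"
proof -
  have norm: "norm (c j * indicat_real (cell j) t) = \<bar>c j\<bar> * indicat_real (cell j) t" for j t
    by (simp add: abs_mult)
  have 1: "AE t in lebesgue_on {0..1}. summable (\<lambda>j. norm (c j * indicat_real (cell j) t))"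
  proof (rule AE_I2)
    fix t :: real
    show "summable (\<lambda>j. norm (c j * indicat_real (cell j) t))"
    proof (cases t rule: step_fun_cases)
      case (1 k)
      show ?thesis by (rule summable_finite[of "{k}"]) (auto simp: 1(2))
    qed simp
  qed
  have 2: "summable (\<lambda>j. \<integral>t. norm (c j * indicat_real (cell j) t) \<partial>lebesgue_on {0..1})"
    unfolding norm cell_integral(2) by (rule assms)
  show "integrable (lebesgue_on {0..1}) (step_fun c)"
    unfolding step_fun_def[abs_def] by (rule integrable_suminf[OF cell_integral(1) 1 2])
  show "(\<integral>t. step_fun c t \<partial>lebesgue_on {0..1}) = (\<Sum>j. c j * cell_length j)"
    unfolding step_fun_def integral_suminf[OF cell_integral(1) 1 2] cell_integral(2) ..
qed

text \<open>Dividing by the length of the cell makes the integral over it equal to the coefficient,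
  so the sequence space of absolutely summable sequences embeds isometrically.\<close>

definition l1_embed :: "(nat \<Rightarrow> real) \<Rightarrow> L1" where
  "l1_embed a = abs_L1 (step_fun (\<lambda>j. a j / cell_length j))"

lemma dist_l1_embed:
  assumes "summable (\<lambda>j. \<bar>a j\<bar>)" "summable (\<lambda>j. \<bar>b j\<bar>)"
  shows "dist (l1_embed a) (l1_embed b) = (\<Sum>j. \<bar>a j - b j\<bar>)"
proof -
  let ?c = "\<lambda>a j. a j / cell_length j"
  have pos: "cell_length j \<noteq> 0" "\<bar>cell_length j\<bar> = cell_length j" for j
    using cell_length_pos[of j] by auto
  have int: "integrable (lebesgue_on {0..1}) (step_fun (?c a))" if "summable (\<lambda>j. \<bar>a j\<bar>)" for a
    by (rule step_fun_integral) (use that pos in simp)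
  have "\<bar>step_fun (?c a) t - step_fun (?c b) t\<bar> = step_fun (\<lambda>j. \<bar>?c a j - ?c b j\<bar>) t" for t
    by (cases t rule: step_fun_cases) auto
  moreover have eq: "\<bar>?c a j - ?c b j\<bar> * cell_length j = \<bar>a j - b j\<bar>" for j
    using pos[of j] by (simp flip: diff_divide_distrib)
  moreover have "summable (\<lambda>j. \<bar>a j - b j\<bar>)"
    by (rule summable_comparison_test[OF _ summable_add[OF assms]]) auto
  ultimately show ?thesis
    unfolding l1_embed_def
    by (simp add: dist_abs_L1 int assms step_fun_integral(2) eq)
qed

lemma countable_l1_embed:
  fixes a :: "'x \<Rightarrow> 'j :: countable \<Rightarrow> real"
  assumes "\<And>x. x \<in> A \<Longrightarrow> (\<lambda>j. \<bar>a x j\<bar>) summable_on UNIV"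
  shows "\<exists>f :: 'x \<Rightarrow> L1. \<forall>x\<in>A. \<forall>y\<in>A. ((\<lambda>j. \<bar>a x j - a y j\<bar>) has_sum dist (f x) (f y)) UNIV"
proof -
  \<comment> \<open>The coordinates are moved to the natural numbers by \<open>to_nat\<close> and
    padded with zeros off its range.\<close>
  define b where "b x n = (if n \<in> range (to_nat :: 'j \<Rightarrow> nat) then a x (from_nat n) else 0)" for x n
  have transfer: "(g has_sum s) (UNIV :: 'j set) \<longleftrightarrow>
      ((\<lambda>n. if n \<in> range (to_nat :: 'j \<Rightarrow> nat) then g (from_nat n) else 0) has_sum s) UNIV"
    for g :: "'j \<Rightarrow> real" and s
  proof -
    have "(g has_sum s) UNIV \<longleftrightarrow> ((\<lambda>n. g (from_nat n)) has_sum s) (range (to_nat :: 'j \<Rightarrow> nat))"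
      using has_sum_reindex[of "to_nat :: 'j \<Rightarrow> nat" UNIV "\<lambda>n. g (from_nat n)" s] by (simp add: o_def)
    also have "\<dots> \<longleftrightarrow> ((\<lambda>n. if n \<in> range (to_nat :: 'j \<Rightarrow> nat) then g (from_nat n) else 0) has_sum s) UNIV"
      by (rule has_sum_cong_neutral) auto
    finally show ?thesis .
  qed
  have sum: "summable (\<lambda>n. \<bar>b x n\<bar>)" if x: "x \<in> A" for x
  proof -
    obtain s where "((\<lambda>j. \<bar>a x j\<bar>) has_sum s) UNIV"
      using assms[OF x] unfolding summable_on_def ..
    then have "((\<lambda>n. if n \<in> range (to_nat :: 'j \<Rightarrow> nat) then \<bar>a x (from_nat n)\<bar> else 0) has_sum s) UNIV"
      by (simp only: transfer)
    moreover have "(\<lambda>n. if n \<in> range (to_nat :: 'j \<Rightarrow> nat) then \<bar>a x (from_nat n)\<bar> else 0) = (\<lambda>n. \<bar>b x n\<bar>)"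
      by (auto simp: b_def)
    ultimately show ?thesis by (metis has_sum_imp_sums sums_summable)
  qed
  have "((\<lambda>j. \<bar>a x j - a y j\<bar>) has_sum dist (l1_embed (b x)) (l1_embed (b y))) UNIV"
    if "x \<in> A" "y \<in> A" for x y
  proof -
    have "summable (\<lambda>n. \<bar>b x n - b y n\<bar>)"
      by (rule summable_comparison_test[OF _ summable_add[OF sum[OF that(1)] sum[OF that(2)]]]) auto
    then have "((\<lambda>n. \<bar>b x n - b y n\<bar>) has_sum dist (l1_embed (b x)) (l1_embed (b y))) UNIV"
      unfolding dist_l1_embed[OF sum[OF that(1)] sum[OF that(2)]]
      by (intro norm_summable_imp_has_sum summable_sums) auto
    moreover have "(\<lambda>n. \<bar>b x n - b y n\<bar>) =
        (\<lambda>n. if n \<in> range (to_nat :: 'j \<Rightarrow> nat) then \<bar>a x (from_nat n) - a y (from_nat n)\<bar> else 0)"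
      by (auto simp: b_def)
    ultimately show ?thesis by (simp only: transfer)
  qed
  then show ?thesis by (intro exI[of _ "\<lambda>x. l1_embed (b x)"]) blast
qed

text \<open>
  The coordinate \<open>(i, m)\<close> indicates the \<open>m\<close>-th block of the \<open>i\<close>-th partition, up to scaling.
  Subtracting its value at a base point \<open>z\<close> makes the coordinates summable.
\<close>

lemma weighted_partitions_embed_L1:
  fixes c :: "'i :: countable \<Rightarrow> 'x \<Rightarrow> nat" and w :: "'i \<Rightarrow> real"
  assumes w: "\<And>i. 0 \<le> w i" and "A \<noteq> {}"
    and sum: "\<And>x y. x \<in> A \<Longrightarrow> y \<in> A \<Longrightarrow> (\<lambda>i. w i * of_bool (c i x \<noteq> c i y)) summable_on UNIV"
  shows "\<exists>f :: 'x \<Rightarrow> L1. \<forall>x\<in>A. \<forall>y\<in>A. ((\<lambda>i. w i * of_bool (c i x \<noteq> c i y)) has_sum dist (f x) (f y)) UNIV"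
proof -
  obtain z where z: "z \<in> A" using assms(2) by blast
  \<comment> \<open>The factor one half compensates that two coordinates change when the blocks
    differ: the block of \<open>x\<close> and the block of \<open>y\<close>.\<close>
  define e where "e x p = w (fst p) / 2 * of_bool (c (fst p) x = snd p)" for x and p :: "'i \<times> nat"
  have inner: "((\<lambda>m. \<bar>e x (i, m) - e y (i, m)\<bar>) has_sum w i * of_bool (c i x \<noteq> c i y)) UNIV" for x y i
    by (rule has_sum_finite_neutralI[of "{c i x, c i y}"]) (use w[of i] in \<open>auto simp: e_def\<close>)
  have has: "((\<lambda>p. \<bar>e x p - e y p\<bar>) has_sum infsum (\<lambda>i. w i * of_bool (c i x \<noteq> c i y)) UNIV) UNIV"
    if "x \<in> A" "y \<in> A" for x y
  proof -
    have "(\<lambda>p. \<bar>e x p - e y p\<bar>) summable_on (SIGMA i:UNIV. UNIV)"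
      by (rule summable_on_SigmaI[OF inner sum[OF that]]) auto
    then have "((\<lambda>p. \<bar>e x p - e y p\<bar>) has_sum infsum (\<lambda>i. w i * of_bool (c i x \<noteq> c i y)) UNIV)
        (SIGMA i:UNIV. UNIV)"
      by (rule has_sum_SigmaI[OF inner has_sum_infsum[OF sum[OF that]]])
    then show ?thesis by simp
  qed
  have "(\<lambda>p. \<bar>e x p - e z p\<bar>) summable_on UNIV" if "x \<in> A" for x
    using has[OF that z] unfolding summable_on_def by blast
  \<comment> \<open>The base point cancels in the difference of two such vectors.\<close>
  from countable_l1_embed[of A "\<lambda>x p. e x p - e z p", OF this]
  obtain f :: "'x \<Rightarrow> L1" where
    f: "\<And>x y. x \<in> A \<Longrightarrow> y \<in> A \<Longrightarrow> ((\<lambda>p. \<bar>e x p - e y p\<bar>) has_sum dist (f x) (f y)) UNIV"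
    by auto
  have "((\<lambda>i. w i * of_bool (c i x \<noteq> c i y)) has_sum dist (f x) (f y)) UNIV"
    if "x \<in> A" "y \<in> A" for x y
    using has_sum_infsum[OF sum[OF that]] has_sum_unique[OF has[OF that] f[OF that]] by simp
  then show ?thesis by (intro exI[of _ f]) blast
qed

subsection \<open>The coarse embedding\<close>

lemma has_complete_minor_antimono:
  assumes "has_complete_minor k V adj" "r \<le> k"
  shows "has_complete_minor r V adj"
proof -
  have "i < k" if "i < r" for i using that assms(2) by simp
  then show ?thesis using assms(1) unfolding has_complete_minor_def by metis
qed

text \<open>The lower control function counts the scales \<open>n\<close> whose diameter bound
  \<open>D n\<close> lies below \<open>t\<close>. The count is finite because \<open>D\<close>
  dominates the identity, and unbounded because any finitely many scales are eventually
  included.\<close>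

lemma filterlim_card_less:
  fixes D :: "nat \<Rightarrow> nat"
  assumes "\<And>n. n \<le> D n"
  shows "filterlim (\<lambda>t. real (card {n. real (D n) < t})) at_top at_top"
    and "mono (\<lambda>t. real (card {n. real (D n) < t}))"
    and "finite {n. real (D n) < t}"
proof -
  have fin: "finite {n. real (D n) < t}" for t
  proof (rule finite_subset)
    show "{n. real (D n) < t} \<subseteq> {..nat \<lceil>t\<rceil>}"
    proof
      fix n assume "n \<in> {n. real (D n) < t}"
      then have "real n < t" using assms[of n] by simp
      then show "n \<in> {..nat \<lceil>t\<rceil>}" by simp linarith
    qed
  qed simp
  then show "finite {n. real (D n) < t}" .
  show mono: "mono (\<lambda>t. real (card {n. real (D n) < t}))"
    by (intro monoI of_nat_mono card_mono fin) auto
  show "filterlim (\<lambda>t. real (card {n. real (D n) < t})) at_top at_top"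
    unfolding filterlim_at_top
  proof
    fix Z :: real
    define N where "N = nat \<lceil>Z\<rceil>"
    have "Z \<le> real (card {n. real (D n) < t})" if "real (Max (D ` {..N})) < t" for t
    proof -
      have "{..N} \<subseteq> {n. real (D n) < t}"
        using that by (auto intro: le_less_trans[of _ "real (Max (D ` {..N}))"])
      then have "card {..N} \<le> card {n. real (D n) < t}" by (rule card_mono[OF fin])
      then show ?thesis unfolding N_def by simp linarith
    qed
    then show "eventually (\<lambda>t. Z \<le> real (card {n. real (D n) < t})) at_top"
      using eventually_gt_at_top by (rule eventually_mono[rotated])
  qed
qed

theorem theorem3:
  fixes r :: nat and V :: "'a set" and adj :: "'a \<Rightarrow> 'a \<Rightarrow> bool"
  assumes "simple_graph V adj"
    and "connected_on V adj"
    and "locally_finite_graph V adj"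
    and "\<not> has_complete_minor r V adj"
  shows "embeds_coarsely V (\<lambda>x y. real (graph_dist V adj x y)) (UNIV :: L1 set) dist"
proof (cases "V = {}")
  case True
  \<comment> \<open>On the empty graph the inequalities are vacuous, but the lower control function
    must still tend to infinity.\<close>
  have "filterlim (\<lambda>t. max 0 t) at_top (at_top :: real filter)"
    by (rule filterlim_at_top_mono[OF filterlim_ident]) simp
  then show ?thesis
    unfolding embeds_coarsely_def coarse_embedding_def True
    by (intro exI[of _ "\<lambda>_. 0"] conjI exI[of _ "\<lambda>t. max 0 t"]) (auto intro!: mono_onI)
next
  case False
  interpret simple_graph V adj by (rule assms(1))
  have V: "walk_connected V" using assms(2) connected_on_iff_walk_connected by blast
  \<comment> \<open>Enlarging \<open>r\<close> keeps the graph minor-free and provides the two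
    branch sets that the minor construction needs.\<close>
  define k where "k = r + 2"
  have k: "2 \<le> k" and nominor: "\<not> has_complete_minor k V adj"
    using assms(4) has_complete_minor_antimono[of k V adj r] unfolding k_def by auto
  let ?d = "graph_dist V adj"
  have d: "y \<in> nbhd V (?d x y) x" "y \<in> nbhd V n x \<Longrightarrow> ?d x y \<le> n" if "x \<in> V" "y \<in> V" for x y n
  proof -
    have comp: "y \<in> comp_of V x" using V that unfolding walk_connected_def by blast
    show "y \<in> nbhd V (?d x y) x" "y \<in> nbhd V n x \<Longrightarrow> ?d x y \<le> n"
      using in_nbhd_height[OF comp] height_le graph_dist_eq_height[OF that(1) comp] by auto
  qed
  \<comment> \<open>The diameter bound of \<open>cluster_weak_diameter\<close> at width
    \<open>2 ^ n\<close> with \<open>k\<close> cuts.\<close>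
  define D where "D n = k * (14 * 2 ^ n + 10 * 2 ^ n * k + 1)" for n :: nat
  have D: "n \<le> D n" for n
  proof -
    have "n \<le> 2 ^ n" by (rule less_imp_le) (rule less_exp)
    also have "\<dots> \<le> 1 * (14 * 2 ^ n + 10 * 2 ^ n * k + 1)" by simp
    also have "\<dots> \<le> D n" unfolding D_def by (rule mult_right_mono) (use k in auto)
    finally show ?thesis .
  qed
  have diam: "?d x y \<le> D n"
    if "x \<in> V" "y \<in> V" "\<sigma>s \<in> offsets (2 ^ n) k" "cluster (2 ^ n) \<sigma>s x = cluster (2 ^ n) \<sigma>s y" for x y n \<sigma>s
  proof -
    have "y \<in> cluster (2 ^ n) \<sigma>s x" using cluster_self[OF that(2)] that(4) by simp
    then have "y \<in> nbhd V (D n) x"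
      unfolding D_def using that(3)
      by (intro cluster_weak_diameter[OF V that(1) k _ nominor]) (auto simp: offsets_def)
    then show ?thesis by (rule d(2)[OF that(1,2)])
  qed
  \<comment> \<open>A cluster is coded by the number of a vertex chosen from it. Equal codes mean a
    common vertex, hence equal clusters.\<close>
  define c where "c = (\<lambda>(n, \<sigma>s) x. to_nat_on V (SOME y. y \<in> cluster (2 ^ n) \<sigma>s x))"
  have c: "c (n, \<sigma>s) x = c (n, \<sigma>s) y \<longleftrightarrow> cluster (2 ^ n) \<sigma>s x = cluster (2 ^ n) \<sigma>s y"
    if "x \<in> V" "y \<in> V" for n \<sigma>s x y
  proof
    let ?s = "\<lambda>x. SOME y. y \<in> cluster (2 ^ n) \<sigma>s x"
    have s: "?s x \<in> cluster (2 ^ n) \<sigma>s x" "?s x \<in> V" if "x \<in> V" for x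
    proof -
      show *: "?s x \<in> cluster (2 ^ n) \<sigma>s x" by (rule someI) (rule cluster_self[OF that])
      then show "?s x \<in> V" using cluster_subset[OF that] by blast
    qed
    assume "c (n, \<sigma>s) x = c (n, \<sigma>s) y"
    then have "?s x = ?s y"
      using inj_onD[OF inj_on_to_nat_on[OF countable_vertices[OF V assms(3)]]] s(2) that
      unfolding c_def by simp
    then show "cluster (2 ^ n) \<sigma>s x = cluster (2 ^ n) \<sigma>s y"
      by (metis cluster_eq s(1) that)
  qed (simp add: c_def)
  \<comment> \<open>At each scale the weights form the uniform probability on offset lists, so every
    scale has total mass one; lists that are not offset lists get weight zero.\<close>
  define w :: "nat \<times> nat list \<Rightarrow> real" where
    "w = (\<lambda>(n, \<sigma>s). of_bool (\<sigma>s \<in> offsets (2 ^ n) k) / (2 ^ n) ^ k)"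
  define \<phi> where "\<phi> x y p = w p * of_bool (c p x \<noteq> c p y)" for x y p
  have \<phi>_pos: "0 \<le> \<phi> x y p" for x y p unfolding \<phi>_def w_def by (cases p) auto
  define I where "I N = (SIGMA n:N. offsets (2 ^ n) k)" for N
  have I_fin: "finite (I N)" if "finite N" for N
    unfolding I_def using that finite_offsets by auto
  have I_sum: "sum (\<phi> x y) (I N) = (\<Sum>n\<in>N. real (card (separating (2 ^ n) k x y)) / (2 ^ n) ^ k)"
    if "x \<in> V" "y \<in> V" "finite N" for x y N
  proof -
    have "(\<Sum>\<sigma>s\<in>offsets (2 ^ n) k. \<phi> x y (n, \<sigma>s)) = real (card (separating (2 ^ n) k x y)) / (2 ^ n) ^ k" for n
    proof -
      have "(\<Sum>\<sigma>s\<in>offsets (2 ^ n) k. \<phi> x y (n, \<sigma>s)) =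
          (\<Sum>\<sigma>s\<in>offsets (2 ^ n) k. of_bool (\<sigma>s \<in> separating (2 ^ n) k x y)) / (2 ^ n) ^ k"
        unfolding sum_divide_distrib
        by (rule sum.cong) (auto simp: \<phi>_def w_def c[OF that(1,2)] separating_def)
      also have "(\<Sum>\<sigma>s\<in>offsets (2 ^ n) k. of_bool (\<sigma>s \<in> separating (2 ^ n) k x y)) =
          real (card (separating (2 ^ n) k x y))"
        using finite_offsets[of "2 ^ n" k] by (simp add: separating_def Int_def)
      finally show ?thesis .
    qed
    moreover have "(\<Sum>n\<in>N. \<Sum>\<sigma>s\<in>offsets (2 ^ n) k. \<phi> x y (n, \<sigma>s)) = sum (\<phi> x y) (I N)"
      unfolding I_def using that(3) finite_offsets by (subst sum.Sigma) (auto simp: case_prod_eta)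
    ultimately show ?thesis by simp
  qed
  have upper: "sum (\<phi> x y) F \<le> 2 * real k * real (?d x y)" if "x \<in> V" "y \<in> V" "finite F" for x y F
  proof -
    \<comment> \<open>All scales up to the largest one in \<open>F\<close> suffice; the inserted
      \<open>0\<close> keeps the maximum defined when \<open>F\<close> is empty. Scale
      \<open>n\<close> contributes at most \<open>k * ?d x y / 2 ^ n\<close>, and the geometric
      series yields the factor 2.\<close>
    let ?N = "{..Max (insert 0 (fst ` F))}"
    have "sum (\<phi> x y) F = sum (\<phi> x y) (F \<inter> I ?N)"
    proof (rule sum.mono_neutral_right[OF that(3)])
      show "\<forall>p\<in>F - F \<inter> I ?N. \<phi> x y p = 0"
      proof
        fix p assume p: "p \<in> F - F \<inter> I ?N"
        have "fst p \<le> Max (insert 0 (fst ` F))" using that(3) p by (intro Max_ge) auto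
        then have "snd p \<notin> offsets (2 ^ fst p) k" using p unfolding I_def by (cases p) auto
        then show "\<phi> x y p = 0" unfolding \<phi>_def w_def by (cases p) simp
      qed
    qed auto
    also have "\<dots> \<le> sum (\<phi> x y) (I ?N)" by (rule sum_mono2) (auto simp: I_fin \<phi>_pos)
    also have "\<dots> = (\<Sum>n\<in>?N. real (card (separating (2 ^ n) k x y)) / (2 ^ n) ^ k)"
      by (rule I_sum) (use that in auto)
    also have "\<dots> \<le> (\<Sum>n\<in>?N. real (k * ?d x y) * (1 / 2) ^ n)"
    proof (rule sum_mono)
      fix n
      have "card (separating (2 ^ n) k x y) * 2 ^ n \<le> ?d x y * (k * (2 ^ n) ^ k)"
        by (rule card_separating[OF V d(1)[OF that(1,2)]])
      then have "real (card (separating (2 ^ n) k x y) * 2 ^ n) \<le> real (?d x y * (k * (2 ^ n) ^ k))"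
        by (rule of_nat_mono)
      then have *: "real (card (separating (2 ^ n) k x y)) * 2 ^ n \<le> real (k * ?d x y) * (2 ^ n) ^ k"
        by (simp add: mult_ac)
      have "real (card (separating (2 ^ n) k x y)) / (2 ^ n) ^ k \<le> real (k * ?d x y) / 2 ^ n"
        using * by (simp add: divide_le_eq le_divide_eq mult_ac)
      then show "real (card (separating (2 ^ n) k x y)) / (2 ^ n) ^ k \<le> real (k * ?d x y) * (1 / 2) ^ n"
        by (simp add: power_divide)
    qed
    also have "\<dots> = real (k * ?d x y) * (\<Sum>n\<in>?N. (1 / 2) ^ n)" by (simp add: sum_distrib_left)
    also have "\<dots> \<le> real (k * ?d x y) * (\<Sum>n. (1 / 2) ^ n)"
      by (intro mult_left_mono sum_le_suminf summable_geometric) auto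
    also have "\<dots> = 2 * real k * real (?d x y)" by (simp add: suminf_geometric)
    finally show ?thesis .
  qed
  have summable: "\<phi> x y summable_on UNIV" if "x \<in> V" "y \<in> V" for x y
    by (rule nonneg_bdd_above_summable_on)
      (auto simp: \<phi>_pos intro!: bdd_aboveI2 upper that)
  obtain f :: "'a \<Rightarrow> L1" where
    f: "\<And>x y. x \<in> V \<Longrightarrow> y \<in> V \<Longrightarrow> (\<phi> x y has_sum dist (f x) (f y)) UNIV"
  proof -
    have "\<exists>f :: 'a \<Rightarrow> L1. \<forall>x\<in>V. \<forall>y\<in>V.
        ((\<lambda>p. w p * of_bool (c p x \<noteq> c p y)) has_sum dist (f x) (f y)) UNIV"
    proof (rule weighted_partitions_embed_L1[OF _ False])
      show "(\<lambda>p. w p * of_bool (c p x \<noteq> c p y)) summable_on UNIV" if "x \<in> V" "y \<in> V" for x y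
        using summable[OF that] unfolding \<phi>_def .
    qed (auto simp: w_def split: prod.splits)
    then show thesis using that unfolding \<phi>_def by blast
  qed
  define \<rho> where "\<rho> t = real (card {n. real (D n) < t})" for t
  note \<rho>_props = filterlim_card_less[of D, OF D, folded \<rho>_def]
  have lower: "\<rho> (?d x y) \<le> dist (f x) (f y)" if xy: "x \<in> V" "y \<in> V" for x y
  proof -
    let ?N = "{n. real (D n) < real (?d x y)}"
    have one: "real (card (separating (2 ^ n) k x y)) / (2 ^ n) ^ k = 1" if "n \<in> ?N" for n
    proof -
      \<comment> \<open>The distance exceeds the diameter bound at this scale, so no choice of
        offsets leaves \<open>x\<close> and \<open>y\<close> together: the scale contributes its
        full mass.\<close>
      have "separating (2 ^ n) k x y = offsets (2 ^ n) k"
        using diam[OF xy, of _ n] that unfolding separating_def by fastforce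
      then show ?thesis by (simp add: card_offsets)
    qed
    have "\<rho> (?d x y) = (\<Sum>n\<in>?N. 1)" unfolding \<rho>_def by simp
    also have "\<dots> = (\<Sum>n\<in>?N. real (card (separating (2 ^ n) k x y)) / (2 ^ n) ^ k)"
      by (rule sum.cong[OF refl one[symmetric]])
    also have "\<dots> = sum (\<phi> x y) (I ?N)" by (rule I_sum[OF xy \<rho>_props(3), symmetric])
    also have "\<dots> \<le> dist (f x) (f y)"
      by (rule finite_sum_le_has_sum[OF f[OF xy] I_fin[OF \<rho>_props(3)]]) (auto simp: \<phi>_pos)
    finally show ?thesis .
  qed
  have dist_le: "dist (f x) (f y) \<le> 2 * real k * real (?d x y)" if "x \<in> V" "y \<in> V" for x y
    by (rule has_sum_le_finite_sums[OF f[OF that] upper[OF that]])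
  have "coarse_embedding V (\<lambda>x y. real (?d x y)) UNIV dist f"
    unfolding coarse_embedding_def
  proof (rule conjI, simp, rule exI[of _ \<rho>], rule exI[of _ "\<lambda>t. 2 * real k * t"], intro conjI)
    show "filterlim \<rho> at_top at_top" by (rule \<rho>_props(1))
    show "mono_on {0..} \<rho>" by (rule mono_on_subset[OF \<rho>_props(2) subset_UNIV])
    show "\<rho> \<in> {0..} \<rightarrow> {0..}" by (simp add: \<rho>_def)
    show "\<forall>x\<in>V. \<forall>y\<in>V. \<rho> (?d x y) \<le> dist (f x) (f y) \<and> dist (f x) (f y) \<le> 2 * real k * real (?d x y)"
      by (intro ballI conjI lower dist_le)
  qed (auto intro!: mono_onI mult_left_mono)
  then show ?thesis unfolding embeds_coarsely_def by blast
qed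

end
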